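(* Let $u$ be an $f$-harmonic function on the Gaussian space $(\mathbb R^n,|\cdot|,e^{-|x|^2/4}dx)$, i.e. a solution on $\mathbb R^n$ of $$\Delta u-\tfrac12\langle x,\nabla u\rangle=0.$$ If $u=O\big(e^{\alpha|x|^2/4}\big)$ as $x\to\infty$ for some $0<\alpha<1$, then $u$ is constant.
   Context: The equation is understood in the weak sense for $u\in W^{1,2}_{\mathrm{loc}}(\mathbb R^n)$: $\int_{\mathbb R^n}\langle\nabla u,\nabla\varphi\rangle e^{-|x|^2/4}dx=0$ for all $0\le\varphi\in C_0^\infty(\mathbb R^n)$ (i.e. $f$-harmonicity with $f(x)=|x|^2/4$). *)

theory Defs
  imports "HOL-Analysis.Analysis" "HOL-Library.Landau_Symbols"
begin

(* For k > 0 this asks that all partial derivatives exist and are of class C^(k-1); total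
   differentiability is then automatic, but demanding it makes frechet_derivative meaningful. *)
primrec C_k :: "nat \<Rightarrow> ('a::euclidean_space \<Rightarrow> real) \<Rightarrow> bool" where
  "C_k 0 \<phi> \<longleftrightarrow> continuous_on UNIV \<phi>"
| "C_k (Suc k) \<phi> \<longleftrightarrow>
     (\<forall>x. \<phi> differentiable (at x)) \<and>
     (\<forall>b\<in>Basis. C_k k (\<lambda>x. frechet_derivative \<phi> (at x) b))"

definition test_function :: "('a::euclidean_space \<Rightarrow> real) \<Rightarrow> bool" where
  "test_function \<phi> \<longleftrightarrow> (\<forall>k. C_k k \<phi>) \<and> compact (closure {x. \<phi> x \<noteq> 0})"

definition gradient :: "('a::euclidean_space \<Rightarrow> real) \<Rightarrow> 'a \<Rightarrow> 'a" where
  "gradient \<phi> x = (\<Sum>b\<in>Basis. frechet_derivative \<phi> (at x) b *\<^sub>R b)"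

definition L2_loc :: "('a::euclidean_space \<Rightarrow> 'b::euclidean_space) \<Rightarrow> bool" where
  "L2_loc g \<longleftrightarrow> g \<in> borel_measurable lebesgue \<and>
     (\<forall>K. compact K \<longrightarrow> set_integrable lebesgue K (\<lambda>x. (norm (g x))\<^sup>2))"

definition weak_gradient :: "('a::euclidean_space \<Rightarrow> real) \<Rightarrow> ('a \<Rightarrow> 'a) \<Rightarrow> bool" where
  "weak_gradient u Du \<longleftrightarrow>
     (\<forall>\<phi>. test_function \<phi> \<longrightarrow> (\<forall>b\<in>Basis.
        (LINT x|lebesgue. u x * (gradient \<phi> x \<bullet> b)) = - (LINT x|lebesgue. (Du x \<bullet> b) * \<phi> x)))"

(* u belongs to W^{1,2}_loc with weak gradient Du (unique up to null sets). *)
definition W12_loc_grad :: "('a::euclidean_space \<Rightarrow> real) \<Rightarrow> ('a \<Rightarrow> 'a) \<Rightarrow> bool" where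
  "W12_loc_grad u Du \<longleftrightarrow> L2_loc u \<and> L2_loc Du \<and> weak_gradient u Du"

(* Weak form of  Laplacian u - <grad f, grad u> = 0,  i.e.  div (e^(-f) grad u) = 0. *)
definition f_harmonic :: "('a::euclidean_space \<Rightarrow> real) \<Rightarrow> ('a \<Rightarrow> real) \<Rightarrow> bool" where
  "f_harmonic f u \<longleftrightarrow>
     (\<exists>Du. W12_loc_grad u Du \<and>
        (\<forall>\<phi>. test_function \<phi> \<and> (\<forall>x. 0 \<le> \<phi> x) \<longrightarrow>
           (LINT x|lebesgue. (Du x \<bullet> gradient \<phi> x) * exp (- f x)) = 0))"

(* Landau's O at infinity for a function determined only up to null sets. *)
definition ae_bigo_at_infinity ::
    "('a::euclidean_space \<Rightarrow> real) \<Rightarrow> ('a \<Rightarrow> real) \<Rightarrow> bool" where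
  "ae_bigo_at_infinity u g \<longleftrightarrow>
     (\<exists>v. (AE x in lebesgue. u x = v x) \<and> v \<in> O[at_infinity](g))"

end

(*
  Put h = u exp(-|x|^2/4). Since alpha < 1, the growth bound makes (1 + |x|^2) h integrable, and that is
  all the proof uses about the growth of u: no gradient estimate is needed. Testing the equation
  against cut-off versions of eta and letting the cut-off tend to 1 gives
  int h (Delta eta - <x, grad eta>/2) = 0 for every eta with moderate bounds. Hence the pairing of h with the
  Ornstein-Uhlenbeck evolution of a Gaussian bump is constant in time. At time infinity the
  evolution is a constant, so the pairing of h with the bump is a multiple of int h that does not
  depend on u. Letting the bumps concentrate shows that h is a multiple of exp(-|x|^2/4).
*)

theory Submission
  imports Defs "HOL-Probability.Distributions"
begin

section \<open>Functions of class \<open>C\<^sup>k\<close>\<close>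

text \<open>Gaussian bumps are used as probes because the Ornstein-Uhlenbeck flow sends Gaussians to
  Gaussians (Mehler's formula). The semigroup need not be constructed: one explicit family, together
  with a first-order equation for its pairing with h, is enough. The invariant weight exp(-|x|^2/4)
  has variance 2, which is the source of the 2 in the variance \<open>s + 2 - 2 * r\<^sup>2\<close>
  along the flow. Concentration at y reads off h(y) at one end of the flow; at the other end y
  enters only through exp(-|y|^2/(2(s + 2))), which tends to exp(-|y|^2/4) as s tends to 0. This is
  how the shape of h is found. The drift term and the errors caused by the cut-off are bounded by
  multiples of 1 + |x|^2, which explains that weight. Since u has no pointwise values, the
  concentration is carried out in integrals over boxes rather than at points.\<close>

lemma frechet_derivative_eqI:
  "(f has_derivative f') (at x) \<Longrightarrow> frechet_derivative f (at x) = f'"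
  by (rule frechet_derivative_at[symmetric])

text \<open>\<open>frechet_derivative\<close> is a choice operator; uniqueness of the derivative
  allows any derivative found by the calculus rules to be supplied in its place.\<close>

lemma C_k_SucI:
  assumes "\<And>x. (f has_derivative f' x) (at x)"
    and "\<And>b. b \<in> Basis \<Longrightarrow> C_k k (\<lambda>x. f' x b)"
  shows "C_k (Suc k) f"
proof -
  have "frechet_derivative f (at x) = f' x" for x
    by (rule frechet_derivative_eqI[OF assms(1)])
  then show ?thesis using assms by (auto simp: differentiable_def)
qed

lemma C_k_Suc_has_derivative:
  "C_k (Suc k) f \<Longrightarrow> (f has_derivative frechet_derivative f (at x)) (at x)"
  by (simp add: frechet_derivative_works[symmetric])

lemma C_k_SucD: "C_k (Suc k) f \<Longrightarrow> C_k k f"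
proof (induction k arbitrary: f)
  case 0
  then show ?case
    by (auto intro!: differentiable_imp_continuous_on simp: differentiable_on_def
        intro: differentiable_at_withinI)
next
  case (Suc k)
  then show ?case by (metis C_k.simps(2))
qed

lemma C_k_const: "C_k k (\<lambda>x. c)"
proof (induction k arbitrary: c)
  case (Suc k)
  show ?case
    by (rule C_k_SucI[OF has_derivative_const]) (rule Suc)
qed simp

lemma C_k_add: "C_k k f \<Longrightarrow> C_k k g \<Longrightarrow> C_k k (\<lambda>x. f x + g x)"
proof (induction k arbitrary: f g)
  case 0
  then show ?case by (simp add: continuous_on_add)
next
  case (Suc k)
  show ?case
    by (rule C_k_SucI[OF has_derivative_add[OF C_k_Suc_has_derivative[OF Suc.prems(1)]
            C_k_Suc_has_derivative[OF Suc.prems(2)]]])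
      (use Suc in auto)
qed

lemma C_k_mult: "C_k k f \<Longrightarrow> C_k k g \<Longrightarrow> C_k k (\<lambda>x. f x * g x)"
proof (induction k arbitrary: f g)
  case 0
  then show ?case by (simp add: continuous_on_mult)
next
  case (Suc k)
  \<comment> \<open>The product rule also contains \<open>f\<close> and \<open>g\<close>
    undifferentiated, so their own class has to be lowered to \<open>k\<close>.\<close>
  note fg = C_k_SucD[OF Suc.prems(1)] C_k_SucD[OF Suc.prems(2)]
  show ?case
    by (rule C_k_SucI[OF has_derivative_mult[OF C_k_Suc_has_derivative[OF Suc.prems(1)]
            C_k_Suc_has_derivative[OF Suc.prems(2)]]])
      (use Suc fg in \<open>auto intro!: C_k_add\<close>)
qed

lemma C_k_inner_left: "C_k k (\<lambda>x. x \<bullet> b)"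
proof (cases k)
  case 0
  then show ?thesis by (simp add: continuous_intros)
next
  case (Suc k')
  show ?thesis unfolding Suc
    by (rule C_k_SucI[where f'="\<lambda>_ h. h \<bullet> b"]) (auto intro!: derivative_eq_intros C_k_const)
qed

lemma C_k_sum: "(\<And>i. i \<in> I \<Longrightarrow> C_k k (f i)) \<Longrightarrow> C_k k (\<lambda>x. \<Sum>i\<in>I. f i x)"
  by (induction I rule: infinite_finite_induct) (auto intro: C_k_const C_k_add)

lemma C_k_norm_square: "C_k k (\<lambda>x::'a::euclidean_space. (norm x)\<^sup>2)"
proof -
  have "C_k k (\<lambda>x::'a. \<Sum>b\<in>Basis. (x \<bullet> b) * (x \<bullet> b))"
    by (intro C_k_sum C_k_mult C_k_inner_left)
  then show ?thesis by (simp add: power2_norm_eq_inner euclidean_inner[symmetric])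
qed

lemma C_k_exp: "C_k k p \<Longrightarrow> C_k k (\<lambda>x. exp (p x))"
proof (induction k)
  case 0
  then show ?case by (simp add: continuous_on_exp)
next
  case (Suc k)
  show ?case
    by (rule C_k_SucI[OF has_derivative_exp[OF C_k_Suc_has_derivative[OF Suc.prems]]])
      (use Suc C_k_SucD[OF Suc.prems] in \<open>auto intro!: C_k_mult\<close>)
qed

section \<open>The flat function behind the smooth cut-off\<close>

text \<open>The functions \<open>t\<^sup>-\<^sup>m e\<^sup>-\<^sup>1\<^sup>/\<^sup>t\<close>, extended by 0 to \<open>t \<le> 0\<close>, have a linear span closed under
  differentiation, which makes the smoothness of the bump function an easy induction.\<close>

definition flat :: "nat \<Rightarrow> real \<Rightarrow> real" where
  "flat m t = (if t \<le> 0 then 0 else exp (- 1 / t) / t ^ m)"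

lemma flat_nonneg: "0 \<le> flat m t"
  by (simp add: flat_def)

lemma flat_nonpos [simp]: "t \<le> 0 \<Longrightarrow> flat m t = 0"
  by (simp add: flat_def)

lemma power_le_fact_exp:
  assumes "0 \<le> (x::real)"
  shows "x ^ n \<le> fact n * exp x"
proof -
  have "(\<Sum>k\<in>{n}. x ^ k /\<^sub>R fact k) \<le> exp x"
    unfolding exp_def
    using assms summable_norm_exp[of x] by (intro sum_le_suminf) auto
  then show ?thesis by (simp add: field_simps)
qed

text \<open>One term of the exponential series at 1/t, of order m + 2, beats the pole of order m
  with two powers of t to spare. These give derivative 0 at the origin and a bound for t at most
  1.\<close>

lemma flat_le_square: "flat m t \<le> fact (m + 2) * t\<^sup>2"
proof (cases "t \<le> 0")
  case False
  have "(1 / t) ^ (m + 2) \<le> fact (m + 2) * exp (1 / t)"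
    by (rule power_le_fact_exp) (use False in simp)
  then show ?thesis using False
    by (simp add: flat_def field_simps exp_minus power_add power2_eq_square)
qed simp

lemma flat_le_fact:
  assumes "t \<le> 1"
  shows "\<bar>flat m t\<bar> \<le> fact (m + 2)"
proof (cases "t \<le> 0")
  case False
  have "flat m t \<le> fact (m + 2) * t\<^sup>2" by (rule flat_le_square)
  also have "\<dots> \<le> fact (m + 2) * 1"
    by (rule mult_left_mono) (use False assms in \<open>auto simp: power_le_one\<close>)
  finally show ?thesis using flat_nonneg[of m t] by simp
qed simp

lemma DERIV_flat: "(flat m has_real_derivative - real m * flat (Suc m) t + flat (m + 2) t) (at t)"
proof -
  consider "t < 0" | "t = 0" | "t > 0" by linarith
  then show ?thesis
  proof cases
    case 1
    have "((\<lambda>_. 0) has_real_derivative 0) (at t)" by simp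
    then have "(flat m has_real_derivative 0) (at t)"
      by (rule has_field_derivative_transform_within_open[of _ _ _ "{..<0}"]) (use 1 in auto)
    then show ?thesis using 1 by simp
  next
    case 2
    \<comment> \<open>By \<open>flat_le_square\<close> the difference quotient at 0 is at most a
      multiple of |y|.\<close>
    have "(flat m has_real_derivative 0) (at 0)"
      unfolding has_field_derivative_iff
    proof (rule Lim_null_comparison)
      have "norm ((flat m y - flat m 0) / (y - 0)) \<le> fact (m + 2) * \<bar>y\<bar>" for y
      proof (cases "y = 0")
        case False
        have "flat m y \<le> fact (m + 2) * \<bar>y\<bar> * \<bar>y\<bar>"
          using flat_le_square[of m y] by (simp only: mult.assoc abs_mult_self_eq power2_eq_square)
        then show ?thesis using False flat_nonneg[of m y]
          by (simp add: pos_divide_le_eq del: fact_Suc)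
      qed simp
      then show "\<forall>\<^sub>F y in at 0. norm ((flat m y - flat m 0) / (y - 0)) \<le> fact (m + 2) * \<bar>y\<bar>"
        by simp
      show "((\<lambda>y. fact (m + 2) * \<bar>y\<bar>) \<longlongrightarrow> (0::real)) (at 0)"
        by (auto intro!: tendsto_eq_intros)
    qed
    then show ?thesis using 2 by simp
  next
    case 3
    \<comment> \<open>The exponent \<open>m - 1\<close> is truncated, hence the case split on
      \<open>m\<close>; for \<open>m = 0\<close> the factor \<open>real m\<close> removes that
      term.\<close>
    have *: "exp (- 1 / t) * (1 / t\<^sup>2) / t ^ m - exp (- 1 / t) * (real m * t ^ (m - 1)) / (t ^ m * t ^ m)
      = - real m * flat (Suc m) t + flat (m + 2) t"
      using 3 by (cases m) (simp_all add: flat_def field_simps power2_eq_square)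
    have "((\<lambda>t. exp (- 1 / t) / t ^ m) has_real_derivative
        - real m * flat (Suc m) t + flat (m + 2) t) (at t)"
      unfolding *[symmetric] using 3
      by (auto intro!: derivative_eq_intros simp: field_simps power2_eq_square)
    then show ?thesis
      by (rule has_field_derivative_transform_within_open[of _ _ _ "{0<..}"])
        (use 3 in \<open>auto simp: flat_def\<close>)
  qed
qed

text \<open>The index \<open>m\<close> must vary in the induction, because differentiation turns
  \<open>flat m\<close> into a combination of \<open>flat (Suc m)\<close> and
  \<open>flat (m + 2)\<close>.\<close>

lemma C_k_flat: "C_k k p \<Longrightarrow> C_k k (\<lambda>x. flat m (p x))"
proof (induction k arbitrary: m)
  case 0
  have "continuous_on UNIV (flat m)"
    using DERIV_isCont[OF DERIV_flat] by (simp add: continuous_on_eq_continuous_at)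
  then show ?case using 0 continuous_on_compose2[of UNIV "flat m" UNIV p] by simp
next
  case (Suc k)
  have "((\<lambda>x. flat m (p x)) has_derivative
      (\<lambda>h. frechet_derivative p (at x) h * (- real m * flat (Suc m) (p x) + flat (m + 2) (p x)))) (at x)" for x
    using has_derivative_compose[OF C_k_Suc_has_derivative[OF Suc.prems]
        DERIV_flat[unfolded has_field_derivative_def], of m x] by (simp add: mult.commute)
  from this show ?case
  proof (rule C_k_SucI)
    fix b :: 'a
    assume "b \<in> Basis"
    then show "C_k k (\<lambda>x. frechet_derivative p (at x) b *
        (- real m * flat (Suc m) (p x) + flat (m + 2) (p x)))"
      using Suc.prems by (intro C_k_mult C_k_add C_k_const Suc.IH C_k_SucD[OF Suc.prems]) simp
  qed
qed

section \<open>Test functions and the very weak equation\<close>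

lemma test_functionI:
  fixes \<phi> :: "'a::euclidean_space \<Rightarrow> real"
  assumes "\<And>k. C_k k \<phi>" and "\<And>x. r < norm x \<Longrightarrow> \<phi> x = 0"
  shows "test_function \<phi>"
proof -
  have "{x. \<phi> x \<noteq> 0} \<subseteq> cball 0 r"
    using assms(2) by (auto simp: not_less[symmetric])
  then have "compact (closure {x. \<phi> x \<noteq> 0})"
    using bounded_subset[OF bounded_cball] compact_closure by blast
  then show ?thesis using assms(1) by (simp add: test_function_def)
qed

lemma test_functionE:
  fixes \<phi> :: "'a::euclidean_space \<Rightarrow> real"
  assumes "test_function \<phi>"
  obtains r B where "\<And>x. r < norm x \<Longrightarrow> \<phi> x = 0" and "\<And>x. \<bar>\<phi> x\<bar> \<le> B" and "0 \<le> B"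
proof -
  have "bounded {x. \<phi> x \<noteq> 0}"
    using assms unfolding test_function_def compact_closure by blast
  then obtain r where r: "\<And>x. \<phi> x \<noteq> 0 \<Longrightarrow> norm x \<le> r"
    by (auto simp: bounded_iff)
  have "continuous_on UNIV \<phi>"
    using assms C_k.simps(1)[of \<phi>] unfolding test_function_def by blast
  then have "compact (\<phi> ` cball 0 r)"
    by (meson compact_cball compact_continuous_image continuous_on_subset top_greatest)
  then obtain B where B: "\<And>x. norm x \<le> r \<Longrightarrow> \<bar>\<phi> x\<bar> \<le> B"
    using compact_imp_bounded by (fastforce simp: bounded_iff)
  \<comment> \<open>If \<open>r\<close> is negative the ball is empty and nothing is known about the
    sign of \<open>B\<close>; hence the maximum with 0.\<close>
  have "\<bar>\<phi> x\<bar> \<le> max 0 B" for x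
    using B[of x] r[of x] by (cases "\<phi> x = 0") auto
  moreover have "\<phi> x = 0" if "r < norm x" for x
    using r[of x] that by fastforce
  ultimately show ?thesis
    by (intro that[of r "max 0 B"]) auto
qed

lemma test_function_mult:
  assumes "test_function \<phi>" and "\<And>k. C_k k g"
  shows "test_function (\<lambda>x. \<phi> x * g x)"
proof -
  obtain r where "\<And>x. r < norm x \<Longrightarrow> \<phi> x = 0"
    using assms(1) by (rule test_functionE) blast
  then show ?thesis using assms
    by (intro test_functionI[of _ r] C_k_mult) (auto simp: test_function_def)
qed

lemma test_function_derivative:
  fixes \<phi> :: "'a::euclidean_space \<Rightarrow> real"
  assumes "test_function \<phi>" and "b \<in> Basis"
  shows "test_function (\<lambda>x. frechet_derivative \<phi> (at x) b)"
proof -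
  obtain r where r: "\<And>x. r < norm x \<Longrightarrow> \<phi> x = 0"
    using assms(1) by (rule test_functionE) blast
  show ?thesis
  proof (rule test_functionI)
    show "C_k k (\<lambda>x. frechet_derivative \<phi> (at x) b)" for k
      using assms C_k.simps(2)[of k \<phi>] by (auto simp: test_function_def)
    fix x :: 'a
    assume x: "r < norm x"
    have "open {x::'a. r < norm x}"
      by (intro open_Collect_less continuous_intros)
    then have "(\<phi> has_derivative (\<lambda>_. 0)) (at x)"
      by (rule has_derivative_transform_within_open[OF has_derivative_const[of 0]])
        (use x r in auto)
    then show "frechet_derivative \<phi> (at x) b = 0"
      by (simp add: frechet_derivative_eqI)
  qed
qed

lemma borel_measurable_C_k:
  assumes "C_k k \<phi>"
  shows "\<phi> \<in> borel_measurable borel"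
proof -
  have "C_k 0 \<phi>" using assms by (induction k arbitrary: \<phi>) (auto dest: C_k_SucD simp del: C_k.simps)
  then show ?thesis by (simp add: borel_measurable_continuous_onI)
qed

text \<open>On the ball that carries \<open>\<phi>\<close>, the elementary bound |g| <= g^2 + 1
  replaces the Cauchy-Schwarz inequality.\<close>

lemma integrable_L2_loc_mult_test:
  fixes g \<phi> :: "'a::euclidean_space \<Rightarrow> real"
  assumes g: "L2_loc g" and \<phi>: "test_function \<phi>"
  shows "integrable lebesgue (\<lambda>x. g x * \<phi> x)"
proof -
  obtain r B where r: "\<And>x. r < norm x \<Longrightarrow> \<phi> x = 0" and B: "\<And>x. \<bar>\<phi> x\<bar> \<le> B" "0 \<le> B"
    using \<phi> by (rule test_functionE) blast
  let ?K = "cball (0::'a) r"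
  have [measurable]: "g \<in> borel_measurable lebesgue"
    using g by (simp add: L2_loc_def)
  have [measurable]: "\<phi> \<in> borel_measurable lebesgue"
    using \<phi> borel_measurable_C_k[of 0 \<phi>] by (auto simp: test_function_def intro: measurable_completion)
  have "set_integrable lebesgue ?K (\<lambda>x. (norm (g x))\<^sup>2)"
    using g by (auto simp: L2_loc_def)
  moreover have "set_integrable lebesgue ?K (\<lambda>x. 1::real)"
    by (simp add: set_integrable_def lmeasurable_iff_integrable[symmetric])
  ultimately have "set_integrable lebesgue ?K (\<lambda>x. (norm (g x))\<^sup>2 + 1)"
    by (rule set_integral_add(1))
  then have "integrable lebesgue (\<lambda>x. B * (indicator ?K x *\<^sub>R ((norm (g x))\<^sup>2 + 1)))"
    by (simp add: set_integrable_def)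
  then show ?thesis
  proof (rule Bochner_Integration.integrable_bound)
    show "AE x in lebesgue. norm (g x * \<phi> x) \<le> norm (B * (indicator ?K x *\<^sub>R ((norm (g x))\<^sup>2 + 1)))"
    proof (rule AE_I2)
      fix x :: 'a
      have "\<bar>g x\<bar> \<le> (g x)\<^sup>2 + 1"
        using zero_le_power2[of "\<bar>g x\<bar> - 1"] by (simp add: power2_eq_square algebra_simps)
      then have "\<bar>\<phi> x\<bar> * \<bar>g x\<bar> \<le> B * ((g x)\<^sup>2 + 1)"
        by (intro mult_mono B) auto
      then show "norm (g x * \<phi> x) \<le> norm (B * (indicator ?K x *\<^sub>R ((norm (g x))\<^sup>2 + 1)))"
        using r[of x] B(2) by (auto simp: indicator_def abs_mult mult.commute)
    qed
  qed simp
qed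

lemma L2_loc_inner:
  fixes g :: "'a::euclidean_space \<Rightarrow> 'b::euclidean_space"
  assumes "L2_loc g" and b: "b \<in> Basis"
  shows "L2_loc (\<lambda>x. g x \<bullet> b)"
  unfolding L2_loc_def
proof (intro conjI allI impI)
  have [measurable]: "g \<in> borel_measurable lebesgue"
    using assms by (simp add: L2_loc_def)
  then show "(\<lambda>x. g x \<bullet> b) \<in> borel_measurable lebesgue" by measurable
  fix K :: "'a set"
  assume "compact K"
  moreover from this have [measurable]: "K \<in> sets lebesgue"
    by (simp add: borel_compact)
  ultimately have "integrable lebesgue (\<lambda>x. indicator K x *\<^sub>R (norm (g x))\<^sup>2)"
    using assms(1) unfolding L2_loc_def set_integrable_def by blast
  then show "set_integrable lebesgue K (\<lambda>x. (norm (g x \<bullet> b))\<^sup>2)"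
    unfolding set_integrable_def
  proof (rule Bochner_Integration.integrable_bound)
    have "(g x \<bullet> b)\<^sup>2 \<le> (norm (g x))\<^sup>2" for x
      using Basis_le_norm[OF b, of "g x"] by (simp add: abs_le_square_iff[symmetric])
    then show "AE x in lebesgue. norm (indicator K x *\<^sub>R (norm (g x \<bullet> b))\<^sup>2)
        \<le> norm (indicator K x *\<^sub>R (norm (g x))\<^sup>2)"
      by (intro AE_I2) (simp add: indicator_def)
  qed simp
qed

lemma gradient_inner_Basis:
  "b \<in> Basis \<Longrightarrow> gradient \<phi> x \<bullet> b = frechet_derivative \<phi> (at x) b"
  by (simp add: gradient_def inner_sum_left inner_Basis if_distrib cong: if_cong)

text \<open>The very weak form: both derivatives are moved to the test function, which is what makes
  bounds on \<open>u\<close> alone sufficient.\<close>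

lemma f_harmonic_very_weak:
  fixes u f :: "'a::euclidean_space \<Rightarrow> real"
  assumes "f_harmonic f u" and f: "\<And>k. C_k k f"
    and \<phi>: "test_function \<phi>" and \<phi>_nonneg: "\<And>x. 0 \<le> \<phi> x"
  shows "(LINT x|lebesgue. u x * ((\<Sum>b\<in>Basis. frechet_derivative (\<lambda>y. frechet_derivative \<phi> (at y) b) (at x) b
      - frechet_derivative f (at x) b * frechet_derivative \<phi> (at x) b) * exp (- f x))) = 0"
proof -
  obtain Du where u: "L2_loc u" and Du: "L2_loc Du" and weak: "weak_gradient u Du"
    and zero: "(LINT x|lebesgue. (Du x \<bullet> gradient \<phi> x) * exp (- f x)) = 0"
    using assms(1) \<phi> \<phi>_nonneg by (auto simp: f_harmonic_def W12_loc_grad_def)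
  let ?D = "\<lambda>b x. frechet_derivative \<phi> (at x) b"
  \<comment> \<open>The equation is tested with nonnegative \<open>\<phi>\<close> only, but
    \<open>weak_gradient\<close> admits every test function, so the fields \<open>\<psi> b\<close>
    of no fixed sign may be used for the integration by parts.\<close>
  define \<psi> where "\<psi> b x = ?D b x * exp (- f x)" for b x
  have "C_k k (\<lambda>x. exp (- f x))" for k
    using C_k_exp[OF C_k_mult[OF C_k_const[of k "-1"] f[of k]]] by simp
  then have \<psi>: "test_function (\<psi> b)" if "b \<in> Basis" for b
    unfolding \<psi>_def by (intro test_function_mult test_function_derivative \<phi> that)
  have \<psi>': "gradient (\<psi> b) x \<bullet> b = (frechet_derivative (?D b) (at x) b
      - frechet_derivative f (at x) b * ?D b x) * exp (- f x)" if b: "b \<in> Basis" for b x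
  proof -
    have "(f has_derivative frechet_derivative f (at x)) (at x)"
      using f[of 1] by (simp add: frechet_derivative_works[symmetric])
    moreover have "(?D b has_derivative frechet_derivative (?D b) (at x)) (at x)"
      using \<phi> C_k.simps(2)[of 1 \<phi>] b
      by (auto simp: test_function_def frechet_derivative_works[symmetric])
    ultimately have "(\<psi> b has_derivative (\<lambda>h. (frechet_derivative (?D b) (at x) h
      - frechet_derivative f (at x) h * ?D b x) * exp (- f x))) (at x)"
      unfolding \<psi>_def by (auto intro!: derivative_eq_intros simp: algebra_simps)
    then show ?thesis
      using b by (simp add: gradient_inner_Basis frechet_derivative_eqI)
  qed
  have "0 = (LINT x|lebesgue. (\<Sum>b\<in>Basis. (Du x \<bullet> b) * \<psi> b x))"
    unfolding zero[symmetric]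
    by (subst euclidean_inner)
      (simp add: gradient_inner_Basis \<psi>_def sum_distrib_right mult.assoc)
  also have "\<dots> = (\<Sum>b\<in>Basis. LINT x|lebesgue. (Du x \<bullet> b) * \<psi> b x)"
    by (intro Bochner_Integration.integral_sum integrable_L2_loc_mult_test L2_loc_inner Du \<psi>)
  also have "\<dots> = - (\<Sum>b\<in>Basis. LINT x|lebesgue. u x * (gradient (\<psi> b) x \<bullet> b))"
    using weak \<psi> unfolding sum_negf[symmetric]
    by (intro sum.cong) (auto simp: weak_gradient_def)
  also have "(\<Sum>b\<in>Basis. LINT x|lebesgue. u x * (gradient (\<psi> b) x \<bullet> b))
      = (LINT x|lebesgue. (\<Sum>b\<in>Basis. u x * (gradient (\<psi> b) x \<bullet> b)))"
    by (rule Bochner_Integration.integral_sum[symmetric])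
      (simp add: gradient_inner_Basis integrable_L2_loc_mult_test test_function_derivative u \<psi>)
  finally show ?thesis
    by (simp add: \<psi>' sum_distrib_left sum_distrib_right)
qed

section \<open>Removing the cut-off\<close>

text \<open>Laplacian minus half the radial drift: the expression in
  \<open>f_harmonic_very_weak\<close> for f = |x|^2/4, an operator symmetric with respect to the
  weight exp(-|x|^2/4).\<close>

definition OU :: "('a::euclidean_space \<Rightarrow> real) \<Rightarrow> 'a \<Rightarrow> real" where
  "OU \<phi> x = (\<Sum>b\<in>Basis. frechet_derivative (\<lambda>y. frechet_derivative \<phi> (at y) b) (at x) b
      - (x \<bullet> b) / 2 * frechet_derivative \<phi> (at x) b)"

lemma C_k_derivative:
  assumes "\<And>k. C_k k \<phi>" and "b \<in> Basis"
  shows "C_k k (\<lambda>x. frechet_derivative \<phi> (at x) b)"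
  using assms C_k.simps(2) by blast

lemma C_k_OU:
  fixes \<phi> :: "'a::euclidean_space \<Rightarrow> real"
  assumes "\<And>k. C_k k \<phi>"
  shows "C_k k (OU \<phi>)"
proof -
  have "C_k k (\<lambda>x. \<Sum>b\<in>Basis. frechet_derivative (\<lambda>y. frechet_derivative \<phi> (at y) b) (at x) b
      + (-1 / 2) * ((x \<bullet> b) * frechet_derivative \<phi> (at x) b))"
    by (intro C_k_sum C_k_add C_k_mult C_k_const C_k_inner_left C_k_derivative assms)
  moreover have "OU \<phi> = (\<lambda>x. \<Sum>b\<in>Basis. frechet_derivative (\<lambda>y. frechet_derivative \<phi> (at y) b) (at x) b
      + (-1 / 2) * ((x \<bullet> b) * frechet_derivative \<phi> (at x) b))"
    by (simp add: OU_def fun_eq_iff)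
  ultimately show ?thesis by simp
qed

lemma f_harmonic_OU_test:
  fixes u :: "'a::euclidean_space \<Rightarrow> real"
  assumes "f_harmonic (\<lambda>x. (norm x)\<^sup>2 / 4) u"
    and "test_function \<phi>" and "\<And>x. 0 \<le> \<phi> x"
  shows "(LINT x|lebesgue. u x * (OU \<phi> x * exp (- (norm x)\<^sup>2 / 4))) = 0"
proof -
  have "C_k k (\<lambda>x::'a. (1 / 4) * (norm x)\<^sup>2)" for k
    by (intro C_k_mult C_k_const C_k_norm_square)
  then have "C_k k (\<lambda>x::'a. (norm x)\<^sup>2 / 4)" for k
    by simp
  moreover have "frechet_derivative (\<lambda>x::'a. (norm x)\<^sup>2 / 4) (at x) = (\<lambda>h. (x \<bullet> h) / 2)" for x
    by (rule frechet_derivative_eqI)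
      (auto intro!: derivative_eq_intros simp: power2_norm_eq_inner inner_commute)
  ultimately show ?thesis
    using f_harmonic_very_weak[OF assms(1) _ assms(2,3)] by (simp add: OU_def)
qed

text \<open>For \<open>m = 0\<close> and \<epsilon> > 0 this is the radial cut-off, supported in
  |x|^2 <= 1/\<epsilon>. Other values of \<open>m\<close> occur in its second derivatives.\<close>

lemma has_derivative_flat:
  fixes x :: "'a::euclidean_space"
  shows "((\<lambda>x. flat m (1 - \<epsilon> * (norm x)\<^sup>2)) has_derivative
    (\<lambda>h. - 2 * \<epsilon> * (x \<bullet> h) * (flat (m + 2) (1 - \<epsilon> * (norm x)\<^sup>2)
      - real m * flat (Suc m) (1 - \<epsilon> * (norm x)\<^sup>2)))) (at x)"
proof -
  have "((\<lambda>x::'a. 1 - \<epsilon> * (norm x)\<^sup>2) has_derivative (\<lambda>h. - 2 * \<epsilon> * (x \<bullet> h))) (at x)"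
    by (auto intro!: derivative_eq_intros simp: power2_norm_eq_inner inner_commute)
  from has_derivative_compose[OF this DERIV_flat[unfolded has_field_derivative_def], of m]
  show ?thesis by (simp add: algebra_simps)
qed

lemma C_k_cutoff: "C_k k (\<lambda>x::'a::euclidean_space. flat m (1 - \<epsilon> * (norm x)\<^sup>2))"
proof -
  have "C_k k (\<lambda>x::'a. flat m (1 + (- \<epsilon>) * (norm x)\<^sup>2))"
    by (intro C_k_flat C_k_add C_k_mult C_k_const C_k_norm_square)
  then show ?thesis by simp
qed

text \<open>Product rule: besides \<open>F 0 * OU \<eta>\<close> there remain \<eta> times
  \<open>OU\<close> of the cut-off and twice the inner product of the gradients. A factor \<epsilon>
  comes out of both, since the cut-off depends on x only through \<epsilon>|x|^2. The indices arise
  from (flat 0)' = flat 2 and (flat 2)' = flat 4 - 2 flat 3.\<close>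

lemma OU_cutoff_mult:
  fixes x :: "'a::euclidean_space" and \<epsilon> :: real
  assumes \<eta>: "\<And>k. C_k k \<eta>"
  defines "F \<equiv> \<lambda>m x. flat m (1 - \<epsilon> * (norm x)\<^sup>2)"
  shows "OU (\<lambda>x. F 0 x * \<eta> x) x = F 0 x * OU \<eta> x
    + \<epsilon> * ((- 2 * real DIM('a) * F 2 x + 4 * \<epsilon> * (norm x)\<^sup>2 * (F 4 x - 2 * F 3 x) + (norm x)\<^sup>2 * F 2 x) * \<eta> x
      - 4 * F 2 x * (\<Sum>b\<in>Basis. (x \<bullet> b) * frechet_derivative \<eta> (at x) b))"
proof -
  let ?D = "\<lambda>b x. frechet_derivative \<eta> (at x) b"
  have \<eta>': "(\<eta> has_derivative frechet_derivative \<eta> (at x)) (at x)" for x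
    using \<eta>[of 1] unfolding One_nat_def by (rule C_k_Suc_has_derivative)
  have D1: "frechet_derivative (\<lambda>x. F 0 x * \<eta> x) (at x) b
      = - 2 * \<epsilon> * (x \<bullet> b) * F 2 x * \<eta> x + F 0 x * ?D b x" for x b
    unfolding F_def
    by (subst frechet_derivative_eqI[OF has_derivative_mult[OF has_derivative_flat \<eta>']])
      (simp del: add_2_eq_Suc')
  have D2: "frechet_derivative (\<lambda>y. frechet_derivative (\<lambda>x. F 0 x * \<eta> x) (at y) b) (at x) b
     = (- 2 * \<epsilon> * F 2 x + 4 * \<epsilon>\<^sup>2 * (x \<bullet> b)\<^sup>2 * (F 4 x - 2 * F 3 x)) * \<eta> x
       - 4 * \<epsilon> * (x \<bullet> b) * F 2 x * ?D b x + F 0 x * frechet_derivative (?D b) (at x) b"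
    if b: "b \<in> Basis" for b
  proof -
    have d: "(?D b has_derivative frechet_derivative (?D b) (at x)) (at x)"
      using C_k_derivative[OF \<eta> b, of 1] unfolding One_nat_def by (rule C_k_Suc_has_derivative)
    have lin: "((\<lambda>x. - 2 * \<epsilon> * (x \<bullet> b)) has_derivative (\<lambda>h. - 2 * \<epsilon> * (h \<bullet> b))) (at x)"
      by (auto intro!: derivative_eq_intros)
    have "frechet_derivative (\<lambda>x. - 2 * \<epsilon> * (x \<bullet> b) * F 2 x * \<eta> x + F 0 x * ?D b x) (at x) b
     = (- 2 * \<epsilon> * F 2 x + 4 * \<epsilon>\<^sup>2 * (x \<bullet> b)\<^sup>2 * (F 4 x - 2 * F 3 x)) * \<eta> x
       - 4 * \<epsilon> * (x \<bullet> b) * F 2 x * ?D b x + F 0 x * frechet_derivative (?D b) (at x) b"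
      unfolding F_def
      by (subst frechet_derivative_eqI[OF has_derivative_add[OF has_derivative_mult[OF
                has_derivative_mult[OF lin has_derivative_flat] \<eta>']
              has_derivative_mult[OF has_derivative_flat d]]])
        (use b in \<open>simp add: algebra_simps power2_eq_square del: add_2_eq_Suc'\<close>)
    then show ?thesis by (simp add: D1)
  qed
  have norm_sq: "(norm x)\<^sup>2 = (\<Sum>b\<in>Basis. (x \<bullet> b)\<^sup>2)"
    by (subst power2_norm_eq_inner, subst euclidean_inner) (simp add: power2_eq_square)
  have "OU (\<lambda>x. F 0 x * \<eta> x) x = (\<Sum>b\<in>Basis. F 0 x * (frechet_derivative (?D b) (at x) b - (x \<bullet> b) / 2 * ?D b x)
      + \<epsilon> * ((- 2 * F 2 x + 4 * \<epsilon> * (x \<bullet> b)\<^sup>2 * (F 4 x - 2 * F 3 x) + (x \<bullet> b)\<^sup>2 * F 2 x) * \<eta> x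
        - 4 * F 2 x * ((x \<bullet> b) * ?D b x)))"
    unfolding OU_def
    by (intro sum.cong refl, simp only: D2, simp only: D1) (simp add: algebra_simps power2_eq_square)
  also have "\<dots> = F 0 x * OU \<eta> x
    + \<epsilon> * ((- 2 * real DIM('a) * F 2 x + 4 * \<epsilon> * (norm x)\<^sup>2 * (F 4 x - 2 * F 3 x) + (norm x)\<^sup>2 * F 2 x) * \<eta> x
      - 4 * F 2 x * (\<Sum>b\<in>Basis. (x \<bullet> b) * ?D b x))"
    unfolding OU_def norm_sq
    by (simp add: sum.distrib sum_subtractf sum_distrib_left sum_distrib_right algebra_simps)
  finally show ?thesis .
qed

text \<open>Pointwise estimate of the bracket multiplied by \<epsilon> in
  \<open>OU_cutoff_mult\<close>, with the value of \<eta> and its partial derivatives as plain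
  numbers.\<close>

lemma OU_cutoff_error:
  fixes x :: "'a::euclidean_space" and \<epsilon> :: real
  assumes \<epsilon>: "0 \<le> \<epsilon>" "\<epsilon> \<le> 1" and "0 \<le> K" and \<eta>: "\<bar>\<eta>\<bar> \<le> K"
    and D: "\<And>b. b \<in> Basis \<Longrightarrow> \<bar>D b\<bar> \<le> K * (1 + norm x)"
  defines "F \<equiv> \<lambda>m. flat m (1 - \<epsilon> * (norm x)\<^sup>2)"
  shows "\<bar>(- 2 * real DIM('a) * F 2 + 4 * \<epsilon> * (norm x)\<^sup>2 * (F 4 - 2 * F 3) + (norm x)\<^sup>2 * F 2) * \<eta>
      - 4 * F 2 * (\<Sum>b\<in>Basis. (x \<bullet> b) * D b)\<bar> \<le> K * (5000 + 300 * real DIM('a)) * (1 + (norm x)\<^sup>2)"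
proof -
  let ?n = "real DIM('a)"
  have F: "\<bar>F m\<bar> \<le> fact (m + 2)" for m
    unfolding F_def by (rule flat_le_fact) (use \<epsilon> in auto)
  \<comment> \<open>These are 4!, 5! and 6!. They lead to 960 = 720 + 2 * 120 and 3864 = 4 * 960 +
    24; the constants 5000 and 300 in the claim are round bounds for 3864 and for 48 + 192.\<close>
  have F2: "\<bar>F 2\<bar> \<le> 24" and F3: "\<bar>F 3\<bar> \<le> 120" and F4: "\<bar>F 4\<bar> \<le> 720"
    using F[of 2] F[of 3] F[of 4] by (simp_all add: fact_numeral)
  have "\<bar>4 * \<epsilon> * (norm x)\<^sup>2 * (F 4 - 2 * F 3)\<bar> \<le> 4 * 1 * (norm x)\<^sup>2 * 960"
    unfolding abs_mult using \<epsilon> F3 F4 by (intro mult_mono) auto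
  moreover have "\<bar>- 2 * ?n * F 2\<bar> \<le> 2 * ?n * 24" and "\<bar>(norm x)\<^sup>2 * F 2\<bar> \<le> (norm x)\<^sup>2 * 24"
    unfolding abs_mult using F2 by (auto intro!: mult_mono)
  ultimately have "\<bar>- 2 * ?n * F 2 + 4 * \<epsilon> * (norm x)\<^sup>2 * (F 4 - 2 * F 3) + (norm x)\<^sup>2 * F 2\<bar>
      \<le> 48 * ?n + 3864 * (norm x)\<^sup>2"
    by linarith
  then have 1: "\<bar>(- 2 * ?n * F 2 + 4 * \<epsilon> * (norm x)\<^sup>2 * (F 4 - 2 * F 3) + (norm x)\<^sup>2 * F 2) * \<eta>\<bar>
      \<le> (48 * ?n + 3864 * (norm x)\<^sup>2) * K"
    unfolding abs_mult[of _ \<eta>] using \<eta> by (intro mult_mono) auto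
  have quad: "norm x * (1 + norm x) \<le> 2 * (1 + (norm x)\<^sup>2)"
    using zero_le_power2[of "norm x - 1"] norm_ge_zero[of x] unfolding power2_eq_square right_diff_distrib left_diff_distrib distrib_left
    by linarith
  have "\<bar>(x \<bullet> b) * D b\<bar> \<le> K * (2 * (1 + (norm x)\<^sup>2))" if b: "b \<in> Basis" for b
  proof -
    have "\<bar>(x \<bullet> b) * D b\<bar> \<le> norm x * (K * (1 + norm x))"
      unfolding abs_mult using Basis_le_norm[OF b] D[OF b] by (intro mult_mono) auto
    also have "\<dots> = K * (norm x * (1 + norm x))" by simp
    also have "\<dots> \<le> K * (2 * (1 + (norm x)\<^sup>2))"
      using quad \<open>0 \<le> K\<close> by (rule mult_left_mono)
    finally show ?thesis .
  qed
  then have "\<bar>\<Sum>b\<in>Basis. (x \<bullet> b) * D b\<bar> \<le> ?n * (K * (2 * (1 + (norm x)\<^sup>2)))"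
    by (intro order.trans[OF sum_abs] sum_bounded_above)
  then have "\<bar>4 * F 2 * (\<Sum>b\<in>Basis. (x \<bullet> b) * D b)\<bar> \<le> 96 * (?n * (K * (2 * (1 + (norm x)\<^sup>2))))"
    unfolding abs_mult[of "4 * F 2"] using F2 by (intro mult_mono) auto
  with 1 have "\<bar>(- 2 * ?n * F 2 + 4 * \<epsilon> * (norm x)\<^sup>2 * (F 4 - 2 * F 3) + (norm x)\<^sup>2 * F 2) * \<eta>
      - 4 * F 2 * (\<Sum>b\<in>Basis. (x \<bullet> b) * D b)\<bar>
    \<le> (48 * ?n + 3864 * (norm x)\<^sup>2) * K + 96 * (?n * (K * (2 * (1 + (norm x)\<^sup>2))))"
    by linarith
  also have "\<dots> = K * (48 * ?n + 3864 * (norm x)\<^sup>2 + 192 * ?n * (1 + (norm x)\<^sup>2))"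
    by (simp add: algebra_simps)
  also have "\<dots> \<le> K * ((5000 + 300 * ?n) * (1 + (norm x)\<^sup>2))"
    using \<open>0 \<le> K\<close> by (intro mult_left_mono) (auto simp: algebra_simps intro!: add_mono mult_right_mono)
  finally show ?thesis by (simp only: mult.assoc)
qed

text \<open>Dominated convergence as the cut-off radius grows: the error is \<epsilon> times a
  function dominated by 1 + |x|^2, so \<open>int\<close> supplies an integrable majorant while
  \<epsilon> makes the error vanish.\<close>

lemma f_harmonic_OU:
  fixes u :: "'a::euclidean_space \<Rightarrow> real"
  assumes u: "f_harmonic (\<lambda>x. (norm x)\<^sup>2 / 4) u"
    and int: "integrable lebesgue (\<lambda>x. (1 + (norm x)\<^sup>2) * (u x * exp (- (norm x)\<^sup>2 / 4)))"
    and \<eta>: "\<And>k. C_k k \<eta>" "\<And>x. 0 \<le> \<eta> x"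
    and K: "\<And>x. \<eta> x \<le> K" "\<And>x b. b \<in> Basis \<Longrightarrow> \<bar>frechet_derivative \<eta> (at x) b\<bar> \<le> K * (1 + norm x)"
      "\<And>x. \<bar>OU \<eta> x\<bar> \<le> K * (1 + (norm x)\<^sup>2)"
  shows "(LINT x|lebesgue. u x * exp (- (norm x)\<^sup>2 / 4) * OU \<eta> x) = 0"
proof -
  let ?f = "\<lambda>x::'a. exp (- (norm x)\<^sup>2 / 4)"
  define \<epsilon> :: "nat \<Rightarrow> real" where "\<epsilon> k = 1 / (real k + 1)" for k
  have \<epsilon>: "0 \<le> \<epsilon> k" "\<epsilon> k \<le> 1" for k
    by (auto simp: \<epsilon>_def)
  have \<epsilon>_lim: "\<epsilon> \<longlonglongrightarrow> 0"
    using LIMSEQ_inverse_real_of_nat by (simp add: \<epsilon>_def[abs_def] inverse_eq_divide add.commute)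
  define \<phi> where "\<phi> k x = flat 0 (1 - \<epsilon> k * (norm x)\<^sup>2) * \<eta> x" for k x
  define C where "C = K * (5000 + 300 * real DIM('a))"
  have "0 \<le> K" using \<eta>(2) K(1) order.trans by blast
  then have "0 \<le> C" by (simp add: C_def)
  have \<phi>_smooth: "C_k i (\<phi> k)" for i k
    unfolding \<phi>_def by (intro C_k_mult C_k_cutoff \<eta>)
  have \<phi>_test: "test_function (\<phi> k)" for k
  proof (rule test_functionI[OF \<phi>_smooth])
    fix x :: 'a
    assume x: "real k + 1 < norm x"
    \<comment> \<open>The support has radius sqrt(k + 1); the larger radius k + 1 avoids the root,
      since norms above 1 are below their squares.\<close>
    then have "norm x * 1 \<le> norm x * norm x" by (intro mult_left_mono) auto
    with x have "real k + 1 \<le> (norm x)\<^sup>2" by (simp add: power2_eq_square)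
    then show "\<phi> k x = 0" by (simp add: \<phi>_def \<epsilon>_def field_simps)
  qed
  have err: "\<bar>OU (\<phi> k) x - flat 0 (1 - \<epsilon> k * (norm x)\<^sup>2) * OU \<eta> x\<bar> \<le> \<epsilon> k * (C * (1 + (norm x)\<^sup>2))" for k x
    using mult_left_mono[OF OU_cutoff_error[OF \<epsilon>[of k] \<open>0 \<le> K\<close>, of "\<eta> x"
          "\<lambda>b. frechet_derivative \<eta> (at x) b" x] \<epsilon>(1)[of k]] K(1,2) \<eta>(2)
    unfolding \<phi>_def OU_cutoff_mult[OF \<eta>(1)] C_def
    by (simp add: abs_mult \<epsilon>)
  have [measurable]: "u \<in> borel_measurable lebesgue"
    using u by (auto simp: f_harmonic_def W12_loc_grad_def L2_loc_def)
  have [measurable]: "OU (\<phi> k) \<in> borel_measurable lebesgue" for k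
    using borel_measurable_C_k[OF C_k_OU[OF \<phi>_smooth], of k] by (auto intro: measurable_completion)
  have [measurable]: "OU \<eta> \<in> borel_measurable lebesgue"
    using borel_measurable_C_k[OF C_k_OU[OF \<eta>(1)]] by (auto intro: measurable_completion)
  have [measurable]: "(\<lambda>x::'a. ?f x) \<in> borel_measurable lebesgue"
    by (rule measurable_completion) simp
  \<comment> \<open>The cut-offs tend to \<open>flat 0 1\<close>, which is exp(-1) and not 1; this
    nonzero constant is cancelled at the end.\<close>
  have "(\<lambda>k. LINT x|lebesgue. u x * (OU (\<phi> k) x * ?f x))
      \<longlonglongrightarrow> (LINT x|lebesgue. u x * ((flat 0 1 * OU \<eta> x) * ?f x))"
  proof (rule integral_dominated_convergence)
    \<comment> \<open>The 2 is the bound 2! on \<open>flat 0\<close>; \<open>C\<close> bounds the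
      error terms, as \<open>\<epsilon> k\<close> is at most 1.\<close>
    show "integrable lebesgue (\<lambda>x. (2 * K + C) * \<bar>(1 + (norm x)\<^sup>2) * (u x * ?f x)\<bar>)"
      using int by simp
    show "AE x in lebesgue. (\<lambda>k. u x * (OU (\<phi> k) x * ?f x)) \<longlonglongrightarrow> u x * ((flat 0 1 * OU \<eta> x) * ?f x)"
    proof (intro AE_I2 tendsto_mult tendsto_const)
      fix x :: 'a
      have "isCont (flat 0) 1" using DERIV_isCont[OF DERIV_flat] .
      moreover have "(\<lambda>k. 1 - \<epsilon> k * (norm x)\<^sup>2) \<longlonglongrightarrow> 1"
        using \<epsilon>_lim by (auto intro!: tendsto_eq_intros)
      ultimately have lim: "(\<lambda>k. flat 0 (1 - \<epsilon> k * (norm x)\<^sup>2) * OU \<eta> x) \<longlonglongrightarrow> flat 0 1 * OU \<eta> x"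
        by (intro tendsto_mult tendsto_const) (rule isCont_tendsto_compose)
      have "(\<lambda>k. OU (\<phi> k) x - flat 0 (1 - \<epsilon> k * (norm x)\<^sup>2) * OU \<eta> x) \<longlonglongrightarrow> 0"
        by (rule Lim_null_comparison[where g="\<lambda>k. \<epsilon> k * (C * (1 + (norm x)\<^sup>2))"])
          (use err \<epsilon>_lim in \<open>auto intro!: tendsto_eq_intros\<close>)
      from tendsto_add[OF this lim] show "(\<lambda>k. OU (\<phi> k) x) \<longlonglongrightarrow> flat 0 1 * OU \<eta> x"
        by simp
    qed
    fix k
    show "AE x in lebesgue. norm (u x * (OU (\<phi> k) x * ?f x))
        \<le> (2 * K + C) * \<bar>(1 + (norm x)\<^sup>2) * (u x * ?f x)\<bar>"
    proof (rule AE_I2)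
      fix x :: 'a
      have "\<bar>flat 0 (1 - \<epsilon> k * (norm x)\<^sup>2)\<bar> \<le> 2"
        using flat_le_fact[of "1 - \<epsilon> k * (norm x)\<^sup>2" 0] \<epsilon>[of k] by (simp add: fact_numeral)
      then have "\<bar>flat 0 (1 - \<epsilon> k * (norm x)\<^sup>2) * OU \<eta> x\<bar> \<le> 2 * (K * (1 + (norm x)\<^sup>2))"
        unfolding abs_mult using K(3) by (intro mult_mono) auto
      moreover have "\<epsilon> k * (C * (1 + (norm x)\<^sup>2)) \<le> 1 * (C * (1 + (norm x)\<^sup>2))"
        using \<epsilon>[of k] \<open>0 \<le> C\<close> by (intro mult_right_mono) auto
      ultimately have "\<bar>OU (\<phi> k) x\<bar> \<le> (2 * K + C) * (1 + (norm x)\<^sup>2)"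
        using err[of k x] by (simp add: algebra_simps)
      then have "\<bar>OU (\<phi> k) x\<bar> * \<bar>u x * ?f x\<bar> \<le> (2 * K + C) * (1 + (norm x)\<^sup>2) * \<bar>u x * ?f x\<bar>"
        by (rule mult_right_mono) simp
      then show "norm (u x * (OU (\<phi> k) x * ?f x)) \<le> (2 * K + C) * \<bar>(1 + (norm x)\<^sup>2) * (u x * ?f x)\<bar>"
        by (simp add: abs_mult mult_ac)
    qed
  qed measurable
  moreover have "(LINT x|lebesgue. u x * (OU (\<phi> k) x * ?f x)) = 0" for k
    by (rule f_harmonic_OU_test[OF u \<phi>_test]) (simp add: \<phi>_def flat_nonneg \<eta>)
  ultimately have "0 = (LINT x|lebesgue. u x * ((flat 0 1 * OU \<eta> x) * ?f x))"
    by (simp add: LIMSEQ_const_iff)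
  also have "\<dots> = (LINT x|lebesgue. flat 0 1 * (u x * ?f x * OU \<eta> x))"
    by (simp add: mult_ac)
  finally show ?thesis
    by (simp add: flat_def)
qed

section \<open>The Ornstein-Uhlenbeck operator on Gaussians\<close>

text \<open>Differentiation under the integral sign: the mean value inequality on the interval turns
  the bound \<open>G\<close> on the derivatives into a bound on all difference quotients, and
  dominated convergence applies along every sequence tending to \<open>\<rho>\<close>.\<close>

lemma DERIV_integral:
  fixes g g' :: "real \<Rightarrow> 'a \<Rightarrow> real"
  assumes \<rho>: "a < \<rho>" "\<rho> < b"
    and g: "\<And>r. a < r \<Longrightarrow> r < b \<Longrightarrow> integrable M (g r)"
    and g': "\<And>r x. a < r \<Longrightarrow> r < b \<Longrightarrow> ((\<lambda>r. g r x) has_real_derivative g' r x) (at r)"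
    and meas: "g' \<rho> \<in> borel_measurable M"
    and bound: "\<And>r x. a < r \<Longrightarrow> r < b \<Longrightarrow> \<bar>g' r x\<bar> \<le> G x"
    and G: "integrable M G"
  shows "((\<lambda>r. LINT x|M. g r x) has_real_derivative (LINT x|M. g' \<rho> x)) (at \<rho>)"
proof -
  let ?S = "{a<..<b}"
  have "((\<lambda>r. ((LINT x|M. g r x) - (LINT x|M. g \<rho> x)) / (r - \<rho>)) \<longlongrightarrow> (LINT x|M. g' \<rho> x)) (at \<rho> within ?S)"
    unfolding tendsto_at_iff_sequentially
  proof (intro allI impI)
    fix X :: "nat \<Rightarrow> real"
    assume X: "\<forall>i. X i \<in> ?S - {\<rho>}" and lim: "X \<longlonglongrightarrow> \<rho>"
    have "(\<lambda>i. LINT x|M. (g (X i) x - g \<rho> x) / (X i - \<rho>)) \<longlonglongrightarrow> (LINT x|M. g' \<rho> x)"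
    proof (rule integral_dominated_convergence[OF meas _ G])
      show "(\<lambda>x. (g (X i) x - g \<rho> x) / (X i - \<rho>)) \<in> borel_measurable M" for i
      proof -
        have [measurable]: "g (X i) \<in> borel_measurable M" "g \<rho> \<in> borel_measurable M"
          using g \<rho> X by (auto intro: borel_measurable_integrable)
        show ?thesis by measurable
      qed
      show "AE x in M. (\<lambda>i. (g (X i) x - g \<rho> x) / (X i - \<rho>)) \<longlonglongrightarrow> g' \<rho> x"
      proof (rule AE_I2)
        fix x
        have "((\<lambda>r. (g r x - g \<rho> x) / (r - \<rho>)) \<longlongrightarrow> g' \<rho> x) (at \<rho>)"
          using g'[OF \<rho>, of x] by (simp add: has_field_derivative_iff)
        then show "(\<lambda>i. (g (X i) x - g \<rho> x) / (X i - \<rho>)) \<longlonglongrightarrow> g' \<rho> x"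
          unfolding tendsto_at_iff_sequentially using X lim by (auto simp: comp_def)
      qed
      show "AE x in M. norm ((g (X i) x - g \<rho> x) / (X i - \<rho>)) \<le> G x" for i
      proof (rule AE_I2)
        fix x
        have "norm (g (X i) x - g \<rho> x) \<le> G x * norm (X i - \<rho>)"
          by (rule field_differentiable_bound[of ?S "\<lambda>r. g r x" "\<lambda>r. g' r x"])
            (use X \<rho> g' bound in \<open>auto intro: has_field_derivative_at_within\<close>)
        moreover have "X i \<noteq> \<rho>" using X by auto
        ultimately show "norm ((g (X i) x - g \<rho> x) / (X i - \<rho>)) \<le> G x"
          by (simp add: pos_divide_le_eq)
      qed
    qed
    then show "((\<lambda>r. ((LINT x|M. g r x) - (LINT x|M. g \<rho> x)) / (r - \<rho>)) \<circ> X) \<longlonglongrightarrow> (LINT x|M. g' \<rho> x)"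
      using X \<rho> g by (auto simp: comp_def)
  qed
  then have "((\<lambda>r. LINT x|M. g r x) has_real_derivative (LINT x|M. g' \<rho> x)) (at \<rho> within ?S)"
    by (simp add: has_field_derivative_iff)
  then show ?thesis
    using \<rho> at_within_open[of \<rho> ?S] by simp
qed

text \<open>Left unnormalised: the factor v^(-n/2) is carried separately. Scale \<open>r\<close> and
  variance \<open>v\<close> are independent here and become linked only along the flow. For
  \<open>r = 1\<close> this is a bump at \<open>y\<close>, for \<open>r = 0\<close> a constant in
  \<open>x\<close>.\<close>

definition gauss :: "'a::euclidean_space \<Rightarrow> real \<Rightarrow> real \<Rightarrow> 'a \<Rightarrow> real" where
  "gauss y v r x = exp (- (norm (r *\<^sub>R x - y))\<^sup>2 / (2 * v))"

lemma gauss_le_1: "0 < v \<Longrightarrow> gauss y v r x \<le> 1"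
  by (simp add: gauss_def)

lemma gauss_nonneg: "0 \<le> gauss y v r x"
  by (simp add: gauss_def)

lemma C_k_gauss: "C_k k (gauss y v r :: 'a::euclidean_space \<Rightarrow> real)"
proof -
  have "C_k k (\<lambda>x::'a. exp ((- 1 / (2 * v)) * (r\<^sup>2 * (norm x)\<^sup>2 + ((- 2 * r) * (x \<bullet> y) + (norm y)\<^sup>2))))"
    by (intro C_k_exp C_k_mult C_k_add C_k_const C_k_norm_square C_k_inner_left)
  moreover have "(norm (r *\<^sub>R x - y))\<^sup>2 = r\<^sup>2 * (norm x)\<^sup>2 + ((- 2 * r) * (x \<bullet> y) + (norm y)\<^sup>2)" for x :: 'a
    unfolding power2_norm_eq_inner by (simp add: inner_diff inner_commute power2_eq_square algebra_simps)
  ultimately show ?thesis by (simp add: gauss_def[abs_def])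
qed

lemma has_derivative_gauss:
  assumes "v \<noteq> 0"
  shows "(gauss y v r has_derivative (\<lambda>h. - (r / v) * ((r *\<^sub>R x - y) \<bullet> h) * gauss y v r x)) (at x)"
proof -
  have "((\<lambda>x. (r *\<^sub>R x - y) \<bullet> (r *\<^sub>R x - y)) has_derivative (\<lambda>h. 2 * r * ((r *\<^sub>R x - y) \<bullet> h))) (at x)"
    by (auto intro!: derivative_eq_intros simp: inner_commute)
  from has_derivative_exp[OF has_derivative_mult_right[OF this, of "- 1 / (2 * v)"]]
  show ?thesis
    using assms by (simp add: gauss_def[abs_def] power2_norm_eq_inner mult_ac)
qed

text \<open>The Laplacian produces the first two terms, and the drift, applied to the gradient
  -(r/v)(rx - y) times the Gaussian, produces the third.\<close>

lemma OU_gauss: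
  fixes x y :: "'a::euclidean_space"
  assumes "v \<noteq> 0"
  shows "OU (gauss y v r) x = gauss y v r x * (r\<^sup>2 * (norm (r *\<^sub>R x - y))\<^sup>2 / v\<^sup>2
    - real DIM('a) * r\<^sup>2 / v + r * ((r *\<^sub>R x - y) \<bullet> x) / (2 * v))"
proof -
  have D1: "frechet_derivative (gauss y v r) (at x) b = - (r / v) * ((r *\<^sub>R x - y) \<bullet> b) * gauss y v r x" for b x
    by (subst frechet_derivative_eqI[OF has_derivative_gauss[OF assms]]) simp
  have D2: "frechet_derivative (\<lambda>x. frechet_derivative (gauss y v r) (at x) b) (at x) b
      = (- r\<^sup>2 / v + r\<^sup>2 / v\<^sup>2 * ((r *\<^sub>R x - y) \<bullet> b)\<^sup>2) * gauss y v r x" if b: "b \<in> Basis" for b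
  proof -
    have lin: "((\<lambda>x. - (r / v) * ((r *\<^sub>R x - y) \<bullet> b)) has_derivative (\<lambda>h. - (r / v) * (r * (h \<bullet> b)))) (at x)"
      using assms by (auto intro!: derivative_eq_intros)
    show ?thesis
      unfolding D1
      by (subst frechet_derivative_eqI[OF has_derivative_mult[OF lin has_derivative_gauss[OF assms]]])
        (use b assms in \<open>simp add: algebra_simps power2_eq_square\<close>)
  qed
  have inn: "(\<Sum>b\<in>Basis. (z \<bullet> b) * (w \<bullet> b)) = z \<bullet> w" for z w :: 'a
    by (rule euclidean_inner[symmetric])
  have nrm: "(\<Sum>b\<in>Basis. (z \<bullet> b)\<^sup>2) = (norm z)\<^sup>2" for z :: 'a
    using inn[of z z] by (simp add: power2_eq_square norm_eq_sqrt_inner)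
  have "OU (gauss y v r) x = gauss y v r x * (\<Sum>b\<in>Basis. r\<^sup>2 / v\<^sup>2 * ((r *\<^sub>R x - y) \<bullet> b)\<^sup>2 - r\<^sup>2 / v
      + r / (2 * v) * (((r *\<^sub>R x - y) \<bullet> b) * (x \<bullet> b)))"
    unfolding OU_def sum_distrib_left
    by (intro sum.cong refl, simp only: D2, simp only: D1) (simp add: algebra_simps)
  also have "(\<Sum>b\<in>Basis. r\<^sup>2 / v\<^sup>2 * ((r *\<^sub>R x - y) \<bullet> b)\<^sup>2 - r\<^sup>2 / v
      + r / (2 * v) * (((r *\<^sub>R x - y) \<bullet> b) * (x \<bullet> b)))
      = r\<^sup>2 / v\<^sup>2 * (norm (r *\<^sub>R x - y))\<^sup>2 - real DIM('a) * (r\<^sup>2 / v) + r / (2 * v) * ((r *\<^sub>R x - y) \<bullet> x)"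
    by (simp only: sum.distrib sum_subtractf sum_constant sum_distrib_left[symmetric] inn nrm)
  finally show ?thesis by simp
qed

lemma norm_affine_le: "norm (r *\<^sub>R x - y) \<le> (\<bar>r\<bar> + norm y) * (1 + norm x)"
proof -
  have "norm (r *\<^sub>R x - y) \<le> \<bar>r\<bar> * norm x + norm y"
    using norm_triangle_ineq4[of "r *\<^sub>R x" y] by simp
  also have "\<dots> \<le> (\<bar>r\<bar> + norm y) * (1 + norm x)"
    by (simp add: algebra_simps)
  finally show ?thesis .
qed

lemma one_plus_norm_square: "(1 + norm x)\<^sup>2 \<le> 2 * (1 + (norm x)\<^sup>2)"
  using zero_le_power2[of "norm x - 1"] unfolding power2_eq_square by (simp add: algebra_simps)

text \<open>The bound \<open>R\<close> makes both estimates uniform in \<open>r\<close>, as is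
  needed to dominate the r-derivative on a whole interval.\<close>

lemma affine_bounds:
  fixes x y :: "'a::euclidean_space"
  assumes "\<bar>r\<bar> + norm y \<le> R"
  shows "(norm (r *\<^sub>R x - y))\<^sup>2 \<le> 2 * R\<^sup>2 * (1 + (norm x)\<^sup>2)"
    and "\<bar>(r *\<^sub>R x - y) \<bullet> x\<bar> \<le> 2 * R * (1 + (norm x)\<^sup>2)"
proof -
  have "0 \<le> R" using assms norm_ge_zero[of y] by linarith
  have w: "norm (r *\<^sub>R x - y) \<le> R * (1 + norm x)"
    using norm_affine_le by (rule order.trans) (intro mult_right_mono assms, simp)
  have "(norm (r *\<^sub>R x - y))\<^sup>2 \<le> (R * (1 + norm x))\<^sup>2"
    using w by (intro power_mono) auto
  also have "\<dots> \<le> R\<^sup>2 * (2 * (1 + (norm x)\<^sup>2))"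
    unfolding power_mult_distrib by (intro mult_left_mono one_plus_norm_square) simp
  finally show "(norm (r *\<^sub>R x - y))\<^sup>2 \<le> 2 * R\<^sup>2 * (1 + (norm x)\<^sup>2)"
    by (simp add: algebra_simps)
  have "\<bar>(r *\<^sub>R x - y) \<bullet> x\<bar> \<le> norm (r *\<^sub>R x - y) * norm x"
    by (rule Cauchy_Schwarz_ineq2)
  also have "\<dots> \<le> R * (1 + norm x) * (1 + norm x)"
    using w \<open>0 \<le> R\<close> by (intro mult_mono) auto
  also have "\<dots> = R * (1 + norm x)\<^sup>2" by (simp add: power2_eq_square)
  also have "\<dots> \<le> R * (2 * (1 + (norm x)\<^sup>2))"
    using \<open>0 \<le> R\<close> by (intro mult_left_mono one_plus_norm_square)
  finally show "\<bar>(r *\<^sub>R x - y) \<bullet> x\<bar> \<le> 2 * R * (1 + (norm x)\<^sup>2)"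
    by (simp add: algebra_simps)
qed

text \<open>Gaussians lack compact support, but they satisfy the three growth bounds of
  \<open>f_harmonic_OU\<close>.\<close>

lemma f_harmonic_OU_gauss:
  fixes u :: "'a::euclidean_space \<Rightarrow> real"
  assumes u: "f_harmonic (\<lambda>x. (norm x)\<^sup>2 / 4) u"
    and int: "integrable lebesgue (\<lambda>x. (1 + (norm x)\<^sup>2) * (u x * exp (- (norm x)\<^sup>2 / 4)))"
    and v: "0 < v"
  shows "(LINT x|lebesgue. u x * exp (- (norm x)\<^sup>2 / 4) * OU (gauss y v r) x) = 0"
proof -
  define R where "R = \<bar>r\<bar> + norm y"
  have "0 \<le> R" by (simp add: R_def)
  \<comment> \<open>\<open>P\<close> adds up the coefficients bounding the three terms of
    \<open>OU_gauss\<close>; \<open>K\<close> is then large enough for the value, the gradient and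
    the operator at once.\<close>
  define P where "P = r\<^sup>2 / v\<^sup>2 * (2 * R\<^sup>2) + real DIM('a) * r\<^sup>2 / v + \<bar>r\<bar> / (2 * v) * (2 * R)"
  define K where "K = 1 + \<bar>r\<bar> / v * R + P"
  have "0 \<le> P" unfolding P_def using v \<open>0 \<le> R\<close> by (intro add_nonneg_nonneg) auto
  moreover have "0 \<le> \<bar>r\<bar> / v * R" using v \<open>0 \<le> R\<close> by simp
  ultimately have K: "1 \<le> K" "\<bar>r\<bar> / v * R \<le> K" "P \<le> K" unfolding K_def by linarith+
  show ?thesis
  proof (rule f_harmonic_OU[OF u int C_k_gauss gauss_nonneg, where K = K])
    fix x :: 'a
    let ?w = "r *\<^sub>R x - y" and ?q = "1 + (norm x)\<^sup>2"
    show "gauss y v r x \<le> K"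
      using gauss_le_1[OF v, of y r x] K(1) by linarith
    show "\<bar>frechet_derivative (gauss y v r) (at x) b\<bar> \<le> K * (1 + norm x)" if b: "b \<in> Basis" for b
    proof -
      have "\<bar>?w \<bullet> b\<bar> \<le> R * (1 + norm x)"
        using Basis_le_norm[OF b, of ?w] norm_affine_le[of r x y] unfolding R_def by linarith
      then have "\<bar>r\<bar> / v * \<bar>?w \<bullet> b\<bar> * gauss y v r x \<le> \<bar>r\<bar> / v * (R * (1 + norm x)) * 1"
        using v \<open>0 \<le> R\<close> by (intro mult_mono gauss_le_1 gauss_nonneg) auto
      also have "\<dots> \<le> K * (1 + norm x)"
        unfolding mult_1_right mult.assoc[symmetric] using K(2) by (intro mult_right_mono) auto
      finally show ?thesis using v
        by (simp add: frechet_derivative_eqI[OF has_derivative_gauss] abs_mult gauss_nonneg)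
    qed
    have "\<bar>r\<^sup>2 * (norm ?w)\<^sup>2 / v\<^sup>2\<bar> \<le> r\<^sup>2 / v\<^sup>2 * (2 * R\<^sup>2 * ?q)"
      using mult_left_mono[OF affine_bounds(1)[of r y R x], of "r\<^sup>2 / v\<^sup>2"] by (simp add: R_def)
    moreover have "\<bar>r * (?w \<bullet> x) / (2 * v)\<bar> \<le> \<bar>r\<bar> / (2 * v) * (2 * R * ?q)"
      using mult_left_mono[OF affine_bounds(2)[of r y R x], of "\<bar>r\<bar> / (2 * v)"] v
      by (simp add: R_def abs_mult)
    moreover have "\<bar>real DIM('a) * r\<^sup>2 / v\<bar> \<le> real DIM('a) * r\<^sup>2 / v * ?q"
      using v mult_left_mono[of 1 ?q "real DIM('a) * r\<^sup>2 / v"] by simp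
    moreover have "\<bar>a - b + c\<bar> \<le> A + B + C" if "\<bar>a\<bar> \<le> A" "\<bar>c\<bar> \<le> C" "\<bar>b\<bar> \<le> B"
      for a b c A B C :: real
      using that by linarith
    ultimately have "\<bar>r\<^sup>2 * (norm ?w)\<^sup>2 / v\<^sup>2 - real DIM('a) * r\<^sup>2 / v + r * (?w \<bullet> x) / (2 * v)\<bar>
        \<le> r\<^sup>2 / v\<^sup>2 * (2 * R\<^sup>2 * ?q) + real DIM('a) * r\<^sup>2 / v * ?q + \<bar>r\<bar> / (2 * v) * (2 * R * ?q)"
      by blast
    also have "\<dots> = P * ?q"
      unfolding P_def by (simp only: distrib_right mult.assoc)
    also have "\<dots> \<le> K * ?q"
      using K(3) by (intro mult_right_mono) auto
    finally have "gauss y v r x * \<bar>r\<^sup>2 * (norm ?w)\<^sup>2 / v\<^sup>2 - real DIM('a) * r\<^sup>2 / v + r * (?w \<bullet> x) / (2 * v)\<bar>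
        \<le> 1 * (K * ?q)"
      by (intro mult_mono gauss_le_1 v) auto
    then show "\<bar>OU (gauss y v r) x\<bar> \<le> K * ?q"
      using v by (simp add: OU_gauss abs_mult gauss_nonneg)
  qed
qed

section \<open>Constancy of the pairing along the flow\<close>

lemma DERIV_gauss:
  assumes "v r \<noteq> 0" and "(v has_real_derivative v') (at r)"
  shows "((\<lambda>r. gauss y (v r) r x) has_real_derivative gauss y (v r) r x *
    ((norm (r *\<^sub>R x - y))\<^sup>2 * v' / (2 * (v r)\<^sup>2) - ((r *\<^sub>R x - y) \<bullet> x) / v r)) (at r)"
proof -
  have "((\<lambda>r. (r *\<^sub>R x - y) \<bullet> (r *\<^sub>R x - y)) has_derivative (\<lambda>h. (2 * ((r *\<^sub>R x - y) \<bullet> x)) * h)) (at r)"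
    by (auto intro!: derivative_eq_intros simp: inner_commute)
  then have N: "((\<lambda>r. (norm (r *\<^sub>R x - y))\<^sup>2) has_real_derivative 2 * ((r *\<^sub>R x - y) \<bullet> x)) (at r)"
    unfolding has_field_derivative_def power2_norm_eq_inner .
  have V: "((\<lambda>r. 2 * v r) has_real_derivative 2 * v') (at r)"
    by (rule DERIV_cmult[OF assms(2)])
  have D: "((\<lambda>r. exp (- ((norm (r *\<^sub>R x - y))\<^sup>2 / (2 * v r)))) has_real_derivative
      exp (- ((norm (r *\<^sub>R x - y))\<^sup>2 / (2 * v r))) * - ((2 * ((r *\<^sub>R x - y) \<bullet> x) * (2 * v r)
        - (norm (r *\<^sub>R x - y))\<^sup>2 * (2 * v')) / (2 * v r * (2 * v r)))) (at r)"
    by (rule DERIV_fun_exp[OF DERIV_minus[OF DERIV_divide[OF N V]]]) (use assms(1) in simp)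
  have eq: "- ((2 * p * (2 * w) - q * (2 * v')) / (2 * w * (2 * w))) = q * v' / (2 * w\<^sup>2) - p / w"
    if "w \<noteq> 0" for p q w :: real
    using that by (simp add: field_simps power2_eq_square)
  from D[unfolded eq[OF assms(1)]] show ?thesis
    unfolding gauss_def minus_divide_left[symmetric] .
qed

text \<open>With \<open>v r = s + 2 - 2 r\<^sup>2\<close>, the functions \<open>(v r)\<^sup>-\<^sup>n\<^sup>/\<^sup>2 gauss y (v r) r\<close> for \<open>r = e\<^sup>-\<^sup>t\<^sup>/\<^sup>2\<close> are the
  Ornstein-Uhlenbeck evolution (Mehler's formula) of the Gaussian of variance \<open>s\<close> centred at \<open>y\<close>. Pairing with \<open>u\<close> is
  constant along it; letting \<open>r\<close> go from 1 to 0 is letting \<open>t\<close> go from 0 to infinity.\<close>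

lemma f_harmonic_gauss_transport:
  fixes u :: "'a::euclidean_space \<Rightarrow> real"
  assumes u: "f_harmonic (\<lambda>x. (norm x)\<^sup>2 / 4) u"
    and int: "integrable lebesgue (\<lambda>x. (1 + (norm x)\<^sup>2) * (u x * exp (- (norm x)\<^sup>2 / 4)))"
    and s: "0 < s"
  shows "s powr (- (real DIM('a) / 2)) * (LINT x|lebesgue. u x * exp (- (norm x)\<^sup>2 / 4) * gauss y s 1 x)
    = (s + 2) powr (- (real DIM('a) / 2)) * gauss y (s + 2) 0 0
      * (LINT x|lebesgue. u x * exp (- (norm x)\<^sup>2 / 4))"
proof -
  define h where "h x = u x * exp (- (norm x)\<^sup>2 / 4)" for x
  define n where "n = real DIM('a)"
  define v where "v r = s + 2 - 2 * r\<^sup>2" for r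
  \<comment> \<open>Chosen so that \<open>v B = s / 2\<close>: the interval from -B to B contains 0
    and 1 in its interior, and \<open>v\<close> stays above s/2 there, which keeps the derivative
    bounds uniform.\<close>
  define B where "B = sqrt (1 + s / 4)"
  define R where "R = B + norm y"
  have B: "1 < B" using s by (simp add: B_def)
  have vB: "s / 2 < v r" if "- B < r" "r < B" for r
  proof -
    have "\<bar>r\<bar>\<^sup>2 < B\<^sup>2" using that by (intro power_strict_mono) auto
    then have "r\<^sup>2 < 1 + s / 4" using s by (simp add: B_def)
    then show ?thesis using s by (simp add: v_def)
  qed
  then have v_pos: "0 < v r" if "- B < r" "r < B" for r
    using that s by (meson half_gt_zero order.strict_trans)
  have Dv: "(v has_real_derivative - 4 * r) (at r)" for r
    unfolding v_def[abs_def] by (auto intro!: derivative_eq_intros)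
  define G' where "G' r x = gauss y (v r) r x *
      ((norm (r *\<^sub>R x - y))\<^sup>2 * (- 4 * r) / (2 * (v r)\<^sup>2) - ((r *\<^sub>R x - y) \<bullet> x) / v r)" for r x
  define L where "L = 4 * B / (2 * (s / 2)\<^sup>2) * (2 * R\<^sup>2) + 1 / (s / 2) * (2 * R)"
  have h_meas [measurable]: "h \<in> borel_measurable lebesgue"
  proof -
    have [measurable]: "u \<in> borel_measurable lebesgue"
      using u by (auto simp: f_harmonic_def W12_loc_grad_def L2_loc_def)
    have [measurable]: "(\<lambda>x::'a. exp (- (norm x)\<^sup>2 / 4)) \<in> borel_measurable lebesgue"
      by (rule measurable_completion) simp
    show ?thesis unfolding h_def[abs_def] by measurable
  qed
  have gauss_meas [measurable]: "gauss y w r \<in> borel_measurable lebesgue" for w r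
    by (rule measurable_completion) (simp add: borel_measurable_C_k[OF C_k_gauss])
  have int_h: "integrable lebesgue (\<lambda>x. (1 + (norm x)\<^sup>2) * h x)"
    using int by (simp add: h_def)
  have int_gauss: "integrable lebesgue (\<lambda>x. h x * gauss y w r x)" if "0 < w" for w r
  proof (rule Bochner_Integration.integrable_bound[OF int_h])
    show "AE x in lebesgue. norm (h x * gauss y w r x) \<le> norm ((1 + (norm x)\<^sup>2) * h x)"
    proof (rule AE_I2)
      fix x
      have "\<bar>h x\<bar> * gauss y w r x \<le> \<bar>h x\<bar> * (1 + (norm x)\<^sup>2)"
        using gauss_le_1[OF that, of y r x] by (intro mult_left_mono) (auto intro: order.trans)
      then show "norm (h x * gauss y w r x) \<le> norm ((1 + (norm x)\<^sup>2) * h x)"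
        by (simp add: abs_mult gauss_nonneg mult.commute)
    qed
  qed measurable
  have bound: "\<bar>G' r x\<bar> \<le> L * (1 + (norm x)\<^sup>2)" if r: "- B < r" "r < B" for r x
  proof -
    let ?w = "r *\<^sub>R x - y" and ?q = "1 + (norm x)\<^sup>2"
    have R: "\<bar>r\<bar> + norm y \<le> R" "\<bar>r\<bar> \<le> B" using r by (auto simp: R_def)
    have "0 \<le> R" using R norm_ge_zero[of y] by linarith
    have sq: "(s / 2)\<^sup>2 \<le> (v r)\<^sup>2" using vB[OF r] s by (intro power_mono) auto
    have "\<bar>(norm ?w)\<^sup>2 * (- 4 * r) / (2 * (v r)\<^sup>2)\<bar> = (norm ?w)\<^sup>2 * (4 * \<bar>r\<bar>) / (2 * (v r)\<^sup>2)"
      by (simp add: abs_mult)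
    also have "\<dots> \<le> (2 * R\<^sup>2 * ?q) * (4 * B) / (2 * (s / 2)\<^sup>2)"
      using affine_bounds(1)[OF R(1)] R(2) sq s B by (intro frac_le mult_mono) auto
    finally have 1: "\<bar>(norm ?w)\<^sup>2 * (- 4 * r) / (2 * (v r)\<^sup>2)\<bar> \<le> 4 * B / (2 * (s / 2)\<^sup>2) * (2 * R\<^sup>2) * ?q"
      by (simp only: times_divide_eq_left times_divide_eq_right mult_ac)
    have "\<bar>(?w \<bullet> x) / v r\<bar> = \<bar>?w \<bullet> x\<bar> / v r"
      using v_pos[OF r] by simp
    also have "\<dots> \<le> (2 * R * ?q) / (s / 2)"
      using affine_bounds(2)[OF R(1)] vB[OF r] s \<open>0 \<le> R\<close> by (intro frac_le) auto
    finally have 2: "\<bar>(?w \<bullet> x) / v r\<bar> \<le> 1 / (s / 2) * (2 * R) * ?q"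
      by (simp add: mult_ac)
    have "\<bar>G' r x\<bar> \<le> 1 * (4 * B / (2 * (s / 2)\<^sup>2) * (2 * R\<^sup>2) * ?q + 1 / (s / 2) * (2 * R) * ?q)"
      unfolding G'_def abs_mult[of "gauss y (v r) r x"] abs_of_nonneg[OF gauss_nonneg]
      by (intro mult_mono gauss_le_1 v_pos r order.trans[OF abs_triangle_ineq4] add_mono 1 2) auto
    then show ?thesis unfolding L_def by (simp only: distrib_right mult_1_left)
  qed
  have G'_meas [measurable]: "G' r \<in> borel_measurable lebesgue" for r
  proof -
    have "(\<lambda>x::'a. (norm (r *\<^sub>R x - y))\<^sup>2 * (- 4 * r) / (2 * (v r)\<^sup>2) - ((r *\<^sub>R x - y) \<bullet> x) / v r)
        \<in> borel_measurable lebesgue"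
      by (rule measurable_completion) simp
    then show ?thesis unfolding G'_def[abs_def] by (intro borel_measurable_times gauss_meas)
  qed
  define \<Phi> where "\<Phi> r = (LINT x|lebesgue. h x * gauss y (v r) r x)" for r
  have D\<Phi>: "(\<Phi> has_real_derivative (LINT x|lebesgue. h x * G' r x)) (at r)" if r: "- B < r" "r < B" for r
    unfolding \<Phi>_def[abs_def]
  proof (rule DERIV_integral[OF r])
    show "integrable lebesgue (\<lambda>x. L * \<bar>(1 + (norm x)\<^sup>2) * h x\<bar>)"
      using int_h by simp
    fix r x assume r: "- B < r" "r < B"
    show "integrable lebesgue (\<lambda>x. h x * gauss y (v r) r x)"
      by (rule int_gauss[OF v_pos[OF r]])
    have "v r \<noteq> 0" using v_pos[OF r] by simp
    from DERIV_cmult[OF DERIV_gauss[OF this Dv]]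
    show "((\<lambda>r. h x * gauss y (v r) r x) has_real_derivative h x * G' r x) (at r)"
      unfolding G'_def .
    have "\<bar>h x\<bar> * \<bar>G' r x\<bar> \<le> \<bar>h x\<bar> * (L * (1 + (norm x)\<^sup>2))"
      by (intro mult_left_mono bound r) simp
    then show "\<bar>h x * G' r x\<bar> \<le> L * \<bar>(1 + (norm x)\<^sup>2) * h x\<bar>"
      by (simp add: abs_mult mult_ac)
  qed measurable
  have int_G': "integrable lebesgue (\<lambda>x. h x * G' r x)" if r: "- B < r" "r < B" for r
  proof (rule Bochner_Integration.integrable_bound)
    show "integrable lebesgue (\<lambda>x. L * \<bar>(1 + (norm x)\<^sup>2) * h x\<bar>)"
      using int_h by simp
    show "AE x in lebesgue. norm (h x * G' r x) \<le> norm (L * \<bar>(1 + (norm x)\<^sup>2) * h x\<bar>)"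
    proof (rule AE_I2)
      fix x
      have "\<bar>h x\<bar> * \<bar>G' r x\<bar> \<le> \<bar>h x\<bar> * (L * (1 + (norm x)\<^sup>2))"
        by (intro mult_left_mono bound r) simp
      then have "\<bar>h x * G' r x\<bar> \<le> L * \<bar>(1 + (norm x)\<^sup>2) * h x\<bar>"
        by (simp add: abs_mult mult_ac)
      also have "\<dots> \<le> \<bar>L * \<bar>(1 + (norm x)\<^sup>2) * h x\<bar>\<bar>" by (rule abs_ge_self)
      finally show "norm (h x * G' r x) \<le> norm (L * \<bar>(1 + (norm x)\<^sup>2) * h x\<bar>)" by simp
    qed
  qed measurable
  have transport: "(LINT x|lebesgue. h x * G' r x) = - (2 * n * r / v r) * \<Phi> r" if r: "0 < r" "r < 1" for r
  proof -
    have rB: "- B < r" "r < B" using r B by auto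
    have v0: "v r \<noteq> 0" using v_pos[OF rB] by simp
    \<comment> \<open>This is the evolution equation for v^(-n/2) times the Gaussian in the
      parameter r = exp(-t/2), where r d/dr = -2 d/dt. The last term is the contribution of the
      factor v^(-n/2).\<close>
    have G'_eq: "- 2 * OU (gauss y (v r) r) x = r * G' r x + 2 * n * r\<^sup>2 / v r * gauss y (v r) r x" for x
      unfolding OU_gauss[OF v0] G'_def n_def using v0
      by (simp add: field_simps power2_eq_square)
    have "0 = - 2 * (LINT x|lebesgue. h x * OU (gauss y (v r) r) x)"
      unfolding h_def using f_harmonic_OU_gauss[OF u int v_pos[OF rB]] by simp
    also have "\<dots> = (LINT x|lebesgue. h x * (- 2 * OU (gauss y (v r) r) x))"
      by (subst integral_mult_right_zero[symmetric]) (simp add: mult_ac)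
    also have "\<dots> = (LINT x|lebesgue. r * (h x * G' r x) + 2 * n * r\<^sup>2 / v r * (h x * gauss y (v r) r x))"
      unfolding G'_eq by (simp add: algebra_simps)
    also have "\<dots> = r * (LINT x|lebesgue. h x * G' r x) + 2 * n * r\<^sup>2 / v r * \<Phi> r"
      unfolding \<Phi>_def
      using int_G'[OF rB] int_gauss[OF v_pos[OF rB]]
      by (subst Bochner_Integration.integral_add) auto
    finally have "r * ((LINT x|lebesgue. h x * G' r x) + 2 * n * r / v r * \<Phi> r) = 0"
      by (simp add: algebra_simps power2_eq_square)
    then show ?thesis using r by simp
  qed
  define W where "W r = exp (- (n / 2) * ln (v r)) * \<Phi> r" for r
  have DA: "((\<lambda>r. exp (- (n / 2) * ln (v r))) has_real_derivative
      exp (- (n / 2) * ln (v r)) * (2 * n * r / v r)) (at r)" if r: "- B < r" "r < B" for r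
    using DERIV_fun_exp[OF DERIV_cmult[OF DERIV_chain2[of ln, OF DERIV_ln_divide[OF v_pos[OF r]] Dv]], of "- (n / 2)"]
    by (simp add: mult_ac)
  \<comment> \<open>The larger interval gives continuity at both ends; inside,
    \<open>transport\<close> makes the two terms of the product rule cancel.\<close>
  have "W 1 = W 0"
  proof (rule DERIV_isconst2[of 0 1])
    have "isCont W r" if "- B < r" "r < B" for r
      unfolding W_def[abs_def] using DERIV_isCont[OF DA] DERIV_isCont[OF D\<Phi>] that by (intro isCont_mult)
    then show "continuous_on {0..1} W"
      using B by (intro continuous_at_imp_continuous_on) auto
    fix r :: real assume r: "0 < r" "r < 1"
    then have rB: "- B < r" "r < B" using B by auto
    show "(W has_real_derivative 0) (at r)"
      unfolding W_def[abs_def]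
      using DERIV_mult[OF DA[OF rB] D\<Phi>[OF rB]] unfolding transport[OF r] by simp
  qed auto
  \<comment> \<open>At \<open>r = 0\<close> the Gaussian no longer depends on \<open>x\<close> and
    leaves the integral.\<close>
  moreover have "\<Phi> 0 = gauss y (s + 2) 0 0 * (LINT x|lebesgue. h x)"
    unfolding \<Phi>_def v_def by (simp add: gauss_def mult.commute)
  ultimately show ?thesis
    using s unfolding W_def \<Phi>_def h_def v_def n_def by (simp add: powr_def)
qed

section \<open>Approximation by Gaussian bumps\<close>

lemma integrable_exp_norm_square:
  fixes c :: real
  assumes "0 < c"
  shows "integrable lborel (\<lambda>x::'a::euclidean_space. exp (- c * (norm x)\<^sup>2))"
proof (rule integrableI_bounded)
  \<comment> \<open>With this standard deviation the normal density is a multiple of exp(-c t^2);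
    Tonelli over the coordinates then handles all dimensions.\<close>
  define \<sigma> where "\<sigma> = sqrt (1 / (2 * c))"
  have \<sigma>: "2 * \<sigma>\<^sup>2 = 1 / c" using assms by (simp add: \<sigma>_def)
  have "0 < \<sigma>" using assms by (simp add: \<sigma>_def)
  then have "integrable lborel (\<lambda>t. sqrt (2 * pi * \<sigma>\<^sup>2) * normal_density 0 \<sigma> t)"
    by simp
  moreover have "sqrt (2 * pi * \<sigma>\<^sup>2) * normal_density 0 \<sigma> t = exp (- c * t\<^sup>2)" for t
    using assms \<sigma> by (simp add: normal_density_def \<sigma>_def)
  ultimately have one: "integrable lborel (\<lambda>t::real. exp (- c * t\<^sup>2))"
    by simp
  have "exp (- c * (norm x)\<^sup>2) = (\<Prod>b\<in>Basis. exp (- c * (x \<bullet> b)\<^sup>2))" for x :: 'a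
    by (subst power2_norm_eq_inner, subst euclidean_inner)
      (simp add: exp_sum sum_distrib_left sum_negf[symmetric] power2_eq_square)
  then have "(\<integral>\<^sup>+x. ennreal (norm (exp (- c * (norm (x::'a))\<^sup>2))) \<partial>lborel)
      = (\<integral>\<^sup>+x. (\<Prod>b\<in>(Basis::'a set). ennreal (exp (- c * (x \<bullet> b)\<^sup>2))) \<partial>lborel)"
    by (simp add: prod_ennreal prod_nonneg)
  also have "\<dots> = (\<Prod>b\<in>(Basis::'a set). (\<integral>\<^sup>+t. ennreal (exp (- c * t\<^sup>2)) \<partial>lborel))"
    by (rule nn_integral_lborel_prod) auto
  also have "\<dots> = (\<Prod>b\<in>(Basis::'a set). ennreal (LINT t|lborel. exp (- c * t\<^sup>2)))"
    using nn_integral_eq_integral[OF one] by simp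
  also have "\<dots> < \<infinity>"
    by (subst prod_ennreal) auto
  finally show "(\<integral>\<^sup>+x. ennreal (norm (exp (- c * (norm (x::'a))\<^sup>2))) \<partial>lborel) < \<infinity>" .
qed simp

lemma lborel_integral_affine:
  fixes g :: "'a::euclidean_space \<Rightarrow> real"
  assumes c: "0 < c" and [measurable]: "g \<in> borel_measurable borel"
  shows "(LINT y|lborel. g y) = c ^ DIM('a) * (LINT z|lborel. g (t + c *\<^sub>R z))"
  using c by (subst lborel_affine[of c t]) (simp_all add: integral_density integral_distr)

text \<open>Dynkin's argument: boxes are closed under intersection and generate the Borel sets, so
  all Borel integrals vanish and the density agrees with 0.\<close>

lemma AE_zero_if_box_integrals_zero:
  fixes g :: "'a::euclidean_space \<Rightarrow> real"
  assumes g: "integrable lborel g" and box: "\<And>a b. (LINT x:box a b|lborel. g x) = 0"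
  shows "AE x in lborel. g x = 0"
proof (rule density_unique_real[OF g])
  let ?G = "range (\<lambda>(a, b). box a b) :: 'a set set"
  have sets_eq: "sets (borel::'a measure) = sigma_sets UNIV ?G"
    by (subst borel_eq_box) simp
  have int: "set_integrable lborel A g" if "A \<in> sets borel" for A
    using g integrable_mult_indicator[of A lborel g] that by (simp add: set_integrable_def)
  \<comment> \<open>Complements require the integral over the whole space, which is not a box but an
    increasing union of boxes.\<close>
  have total: "(LINT x:UNIV|lborel. g x) = 0"
  proof -
    let ?A = "\<lambda>i::nat. box (- (real i *\<^sub>R One)) (real i *\<^sub>R One) :: 'a set"
    have "incseq ?A"
      by (rule incseq_SucI) (auto simp: box_def inner_sum_left_Basis)
    then have "(\<lambda>i. LINT x:?A i|lborel. g x) \<longlonglongrightarrow> (LINT x:(\<Union>i. ?A i)|lborel. g x)"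
      by (intro set_integral_cont_up int) auto
    then show ?thesis
      unfolding UN_box_eq_UNIV box by (simp add: LIMSEQ_const_iff)
  qed
  fix A :: "'a set"
  assume "A \<in> sets lborel"
  then have A: "A \<in> sigma_sets UNIV ?G" by (simp add: sets_eq)
  have "Int_stable ?G"
    by (auto simp: Int_stable_def box_Int_box)
  moreover have "?G \<subseteq> Pow UNIV" by simp
  ultimately have "(LINT x:A|lborel. g x) = 0"
    using A
  proof (induction rule: sigma_sets_induct_disjoint)
    case (basic A)
    then show ?case using box by auto
  next
    case empty
    then show ?case by (simp add: set_lebesgue_integral_def)
  next
    case (compl A)
    then have "A \<in> sets borel" "UNIV - A \<in> sets borel" by (auto simp: sets_eq sigma_sets.Compl)
    then have "(LINT x:A \<union> (UNIV - A)|lborel. g x) = (LINT x:A|lborel. g x) + (LINT x:UNIV - A|lborel. g x)"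
      by (intro set_integral_Un int) auto
    moreover have "A \<union> (UNIV - A) = UNIV" by auto
    ultimately show ?case using total compl by simp
  next
    case (union A)
    have A: "A i \<in> sets borel" for i using union by (auto simp: sets_eq)
    have "(LINT x:(\<Union>i. A i)|lborel. g x) = (\<Sum>i. LINT x:A i|lborel. g x)"
      by (rule lebesgue_integral_countable_add)
        (use union A int in \<open>auto simp: disjoint_family_on_def\<close>)
    then show ?case using union by simp
  qed
  then show "(LINT x:A|lborel. g x) = (LINT x:A|lborel. 0)"
    by (simp add: set_lebesgue_integral_def)
qed simp

lemma integrable_indicator_box:
  "integrable lborel (indicator (box a b) :: 'a::euclidean_space \<Rightarrow> real)"
  using emeasure_lborel_box_finite[of a b] by (intro integrable_real_indicator) auto

text \<open>Gaussian smoothing as an approximate identity, tested on a box. Fubini moves the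
  smoothing from \<open>h\<close> to the indicator, where convergence is elementary and no Lebesgue
  points are involved.\<close>

lemma gauss_smoothing_box:
  fixes h :: "'a::euclidean_space \<Rightarrow> real" and \<epsilon> :: "nat \<Rightarrow> real"
  assumes h: "integrable lborel h" and \<epsilon>: "\<And>k. 0 < \<epsilon> k" "\<epsilon> \<longlonglongrightarrow> 0"
  shows "(\<lambda>k. LINT y|lborel. indicator (box a b) y * ((LINT x|lborel. h x * gauss y ((\<epsilon> k)\<^sup>2) 1 x) / \<epsilon> k ^ DIM('a)))
    \<longlonglongrightarrow> (LINT z|lborel. exp (- (norm (z::'a))\<^sup>2 / 2)) * (LINT x:box a b|lborel. h x)"
proof -
  let ?U = "box a b" and ?E = "\<lambda>z::'a. exp (- (norm z)\<^sup>2 / 2)"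
  let ?I = "indicator ?U :: 'a \<Rightarrow> real"
  have [measurable]: "h \<in> borel_measurable borel" using h by auto
  have E: "integrable lborel ?E"
    using integrable_exp_norm_square[of "1 / 2", where 'a='a] by simp
  define J where "J k x = (LINT z|lborel. ?I (x + \<epsilon> k *\<^sub>R z) * ?E z)" for k x
  have bound: "\<bar>?I w * ?E z\<bar> \<le> ?E z" for w z
    by (simp add: indicator_def)
  have J_meas [measurable]: "J k \<in> borel_measurable borel" for k
    unfolding J_def[abs_def] by (rule lborel.borel_measurable_lebesgue_integral) measurable
  have J_bound: "\<bar>J k x\<bar> \<le> integral\<^sup>L lborel ?E" for k x
  proof -
    have "\<bar>J k x\<bar> \<le> (LINT z|lborel. \<bar>?I (x + \<epsilon> k *\<^sub>R z) * ?E z\<bar>)"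
      unfolding J_def by (rule integral_abs_bound)
    also have "\<dots> \<le> integral\<^sup>L lborel ?E"
      by (rule integral_mono[OF _ E bound], rule Bochner_Integration.integrable_bound[OF E])
        (auto simp: indicator_def)
    finally show ?thesis .
  qed
  have swap: "(LINT y|lborel. ?I y * ((LINT x|lborel. h x * gauss y ((\<epsilon> k)\<^sup>2) 1 x) / \<epsilon> k ^ DIM('a)))
      = (LINT x|lborel. h x * J k x)" for k
  proof -
    let ?c = "\<epsilon> k ^ DIM('a)" and ?g = "\<lambda>x y::'a. exp (- (norm (x - y))\<^sup>2 / (2 * (\<epsilon> k)\<^sup>2))"
    have g: "gauss y ((\<epsilon> k)\<^sup>2) 1 x = ?g x y" for x y by (simp add: gauss_def)
    have g_bound: "\<bar>h x * ?I y * ?g x y\<bar> \<le> \<bar>h x * ?I y\<bar>" for x y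
      unfolding abs_mult[of "h x * ?I y"] by (rule mult_left_le) simp_all
    \<comment> \<open>The Gaussian factor is at most 1, so this product is a majorant that justifies
      Fubini.\<close>
    have "integrable (lborel \<Otimes>\<^sub>M lborel) (\<lambda>(x, y). h x * ?I y)"
    proof (rule lborel_pair.Fubini_integrable)
      have "integrable lborel (\<lambda>x. \<bar>h x\<bar> * (LINT y|lborel. ?I y))"
        using h by simp
      then show "integrable lborel (\<lambda>x. LINT y|lborel. norm (case (x, y) of (x, y) \<Rightarrow> h x * ?I y))"
        by (simp add: abs_mult)
      show "AE x in lborel. integrable lborel (\<lambda>y. case (x, y) of (x, y) \<Rightarrow> h x * ?I y)"
        using integrable_indicator_box[of a b] by simp
    qed measurable
    then have "integrable (lborel \<Otimes>\<^sub>M lborel) (\<lambda>(x, y). h x * ?I y * ?g x y)"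
      by (rule Bochner_Integration.integrable_bound) (use g_bound in \<open>auto simp: split_beta\<close>)
    from lborel_pair.Fubini_integral[OF this]
    have fub: "(LINT y|lborel. LINT x|lborel. h x * ?I y * ?g x y) = (LINT x|lborel. LINT y|lborel. h x * ?I y * ?g x y)" .
    \<comment> \<open>Substituting y = x + \<epsilon> z; the Jacobian cancels the normalisation of
      the bump.\<close>
    have inner: "(LINT y|lborel. ?I y * ?g x y) = ?c * J k x" for x
      unfolding J_def
      using \<epsilon>(1)[of k] by (subst lborel_integral_affine[of "\<epsilon> k" _ x]) (simp_all add: power_mult_distrib)
    have "(LINT y|lborel. ?I y * ((LINT x|lborel. h x * gauss y ((\<epsilon> k)\<^sup>2) 1 x) / ?c))
      = (LINT y|lborel. (LINT x|lborel. h x * ?I y * ?g x y) / ?c)"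
      unfolding g by (subst times_divide_eq_right, subst integral_mult_right_zero[symmetric]) (simp add: mult_ac)
    also have "\<dots> = (LINT y|lborel. LINT x|lborel. h x * ?I y * ?g x y) / ?c"
      by (rule integral_divide_zero)
    also have "\<dots> = (LINT x|lborel. h x * (LINT y|lborel. ?I y * ?g x y)) / ?c"
      unfolding fub by (simp only: mult.assoc integral_mult_right_zero)
    also have "\<dots> = (LINT x|lborel. ?c * (h x * J k x)) / ?c"
      unfolding inner by (simp add: mult_ac)
    also have "\<dots> = (LINT x|lborel. h x * J k x)"
      unfolding integral_mult_right_zero using \<epsilon>(1)[of k] by simp
    finally show ?thesis .
  qed
  \<comment> \<open>Off the frontier, \<open>x\<close> lies in the open box or in the open
    complement of the closed one, so the indicator is eventually constant along
    \<open>x + \<epsilon> k *\<^sub>R z\<close>. The frontier is a null set.\<close>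
  have lim_J: "(\<lambda>k. J k x) \<longlonglongrightarrow> ?I x * integral\<^sup>L lborel ?E" if x: "x \<notin> cbox a b - box a b" for x
    unfolding J_def integral_mult_right_zero[symmetric]
  proof (rule integral_dominated_convergence[OF _ _ E])
    show "AE z in lborel. (\<lambda>k. ?I (x + \<epsilon> k *\<^sub>R z) * ?E z) \<longlonglongrightarrow> ?I x * ?E z"
    proof (intro AE_I2 tendsto_mult tendsto_const)
      fix z
      have lim: "(\<lambda>k. x + \<epsilon> k *\<^sub>R z) \<longlonglongrightarrow> x"
        using \<epsilon>(2) by (auto intro!: tendsto_eq_intros)
      have "eventually (\<lambda>k. ?I (x + \<epsilon> k *\<^sub>R z) = ?I x) sequentially"
      proof (cases "x \<in> ?U")
        case True
        have "eventually (\<lambda>k. x + \<epsilon> k *\<^sub>R z \<in> ?U) sequentially"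
          by (rule topological_tendstoD[OF lim open_box True])
        then show ?thesis by eventually_elim (simp add: True)
      next
        case False
        have "eventually (\<lambda>k. x + \<epsilon> k *\<^sub>R z \<in> - cbox a b) sequentially"
          by (rule topological_tendstoD[OF lim]) (use x False in \<open>auto simp: closed_cbox\<close>)
        then show ?thesis
          by eventually_elim (use False box_subset_cbox in \<open>auto simp: indicator_def\<close>)
      qed
      then show "(\<lambda>k. ?I (x + \<epsilon> k *\<^sub>R z)) \<longlonglongrightarrow> ?I x"
        by (rule tendsto_eventually)
    qed
    show "AE z in lborel. norm (?I (x + \<epsilon> k *\<^sub>R z) * ?E z) \<le> ?E z" for k
      using bound by simp
  qed measurable
  have "(\<lambda>k. LINT x|lborel. h x * J k x) \<longlonglongrightarrow> (LINT x|lborel. h x * (?I x * integral\<^sup>L lborel ?E))"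
  proof (rule integral_dominated_convergence)
    show "integrable lborel (\<lambda>x. \<bar>h x\<bar> * integral\<^sup>L lborel ?E)"
      using h by simp
    have "cbox a b - box a b \<in> null_sets lborel"
      using negligible_frontier_interval by (simp add: negligible_iff_null_sets null_sets_completion_iff)
    then have "AE x in lborel. x \<notin> cbox a b - box a b"
      by (rule AE_not_in)
    then show "AE x in lborel. (\<lambda>k. h x * J k x) \<longlonglongrightarrow> h x * (?I x * integral\<^sup>L lborel ?E)"
      by eventually_elim (intro tendsto_mult tendsto_const lim_J)
    show "AE x in lborel. norm (h x * J k x) \<le> \<bar>h x\<bar> * integral\<^sup>L lborel ?E" for k
      using J_bound by (intro AE_I2) (auto simp: abs_mult intro: mult_left_mono)
  qed measurable
  also have "(LINT x|lborel. h x * (?I x * integral\<^sup>L lborel ?E)) = integral\<^sup>L lborel ?E * (LINT x:?U|lborel. h x)"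
    unfolding set_lebesgue_integral_def integral_mult_right_zero[symmetric] by (simp add: mult_ac)
  finally show ?thesis unfolding swap .
qed

text \<open>The right-hand side depends on \<open>y\<close> only through an explicit Gaussian. As s
  tends to 0, the left-hand side recovers \<open>h\<close> up to a factor and the right-hand side
  tends to a multiple of exp(-|y|^2/4).\<close>

lemma AE_eq_exp_if_transport:
  fixes h :: "'a::euclidean_space \<Rightarrow> real"
  assumes h: "integrable lborel h"
    and transport: "\<And>s y. 0 < s \<Longrightarrow> s powr (- (real DIM('a) / 2)) * (LINT x|lborel. h x * gauss y s 1 x)
      = (s + 2) powr (- (real DIM('a) / 2)) * gauss y (s + 2) 0 0 * I"
  shows "\<exists>c. AE x in lborel. h x = c * exp (- (norm x)\<^sup>2 / 4)"
proof -
  let ?p = "- (real DIM('a) / 2)"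
  define \<epsilon> :: "nat \<Rightarrow> real" where "\<epsilon> k = 1 / (real k + 1)" for k
  have \<epsilon>: "0 < \<epsilon> k" for k
    by (simp add: \<epsilon>_def)
  have \<epsilon>_lim: "\<epsilon> \<longlonglongrightarrow> 0"
    using LIMSEQ_inverse_real_of_nat by (simp add: \<epsilon>_def[abs_def] inverse_eq_divide add.commute)
  define Z where "Z = (LINT z|lborel. exp (- (norm (z::'a))\<^sup>2 / 2))"
  have "integrable lborel (\<lambda>z::'a. exp (- (norm z)\<^sup>2 / 2))"
    using integrable_exp_norm_square[of "1 / 2", where 'a='a] by simp
  \<comment> \<open>The exponential never vanishes, so \<open>Z = 0\<close> would make the whole
    space a null set.\<close>
  then have "Z = 0 \<longleftrightarrow> (AE z::'a in lborel. False)"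
    unfolding Z_def by (subst integral_nonneg_eq_0_iff_AE) auto
  then have "Z \<noteq> 0"
    by (simp add: eventually_False ae_filter_eq_bot_iff)
  define c where "c = 2 powr ?p * I"
  have E: "integrable lborel (\<lambda>x::'a. exp (- (norm x)\<^sup>2 / 4))"
    using integrable_exp_norm_square[of "1 / 4", where 'a='a] by simp
  \<comment> \<open>For \<open>s = (\<epsilon> k)\<^sup>2\<close> the factor s^(-n/2) is exactly the
    normalisation in \<open>gauss_smoothing_box\<close>.\<close>
  have smoothed: "(LINT x|lborel. h x * gauss y ((\<epsilon> k)\<^sup>2) 1 x) / \<epsilon> k ^ DIM('a)
      = ((\<epsilon> k)\<^sup>2 + 2) powr ?p * gauss y ((\<epsilon> k)\<^sup>2 + 2) 0 0 * I" for k y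
  proof -
    have "((\<epsilon> k)\<^sup>2) powr ?p = (\<epsilon> k powr 2) powr ?p"
      using \<epsilon>[of k] by (simp add: powr_numeral)
    also have "\<dots> = 1 / \<epsilon> k ^ DIM('a)"
      unfolding powr_powr using \<epsilon>[of k] by (simp add: powr_minus powr_realpow inverse_eq_divide)
    finally show ?thesis
      using transport[of "(\<epsilon> k)\<^sup>2" y] \<epsilon>[of k] by simp
  qed
  have "(LINT x:box a b|lborel. Z * h x - c * exp (- (norm x)\<^sup>2 / 4)) = 0" for a b :: 'a
  proof -
    let ?I = "indicator (box a b) :: 'a \<Rightarrow> real"
    have "(\<lambda>k. LINT y|lborel. ?I y * (((\<epsilon> k)\<^sup>2 + 2) powr ?p * gauss y ((\<epsilon> k)\<^sup>2 + 2) 0 0 * I))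
        \<longlonglongrightarrow> Z * (LINT x:box a b|lborel. h x)"
      using gauss_smoothing_box[OF h \<epsilon> \<epsilon>_lim, of a b] unfolding smoothed Z_def .
    moreover have "(\<lambda>k. LINT y|lborel. ?I y * (((\<epsilon> k)\<^sup>2 + 2) powr ?p * gauss y ((\<epsilon> k)\<^sup>2 + 2) 0 0 * I))
        \<longlonglongrightarrow> (LINT y|lborel. ?I y * (2 powr ?p * exp (- (norm y)\<^sup>2 / 4) * I))"
    proof (rule integral_dominated_convergence)
      show "integrable lborel (\<lambda>y. ?I y * \<bar>I\<bar>)"
        using integrable_indicator_box[of a b] by simp
      show "AE y in lborel. (\<lambda>k. ?I y * (((\<epsilon> k)\<^sup>2 + 2) powr ?p * gauss y ((\<epsilon> k)\<^sup>2 + 2) 0 0 * I))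
          \<longlonglongrightarrow> ?I y * (2 powr ?p * exp (- (norm y)\<^sup>2 / 4) * I)"
      proof (intro AE_I2 tendsto_mult tendsto_const)
        fix y :: 'a
        have lim: "(\<lambda>k. (\<epsilon> k)\<^sup>2 + 2) \<longlonglongrightarrow> 2"
          using \<epsilon>_lim by (auto intro!: tendsto_eq_intros)
        then show "(\<lambda>k. ((\<epsilon> k)\<^sup>2 + 2) powr ?p) \<longlonglongrightarrow> 2 powr ?p"
          by (intro tendsto_powr tendsto_const) auto
        have "(\<lambda>k. exp (- (norm y)\<^sup>2 / (2 * ((\<epsilon> k)\<^sup>2 + 2)))) \<longlonglongrightarrow> exp (- (norm y)\<^sup>2 / (2 * 2))"
          by (intro tendsto_intros lim) simp
        then show "(\<lambda>k. gauss y ((\<epsilon> k)\<^sup>2 + 2) 0 0) \<longlonglongrightarrow> exp (- (norm y)\<^sup>2 / 4)"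
          by (simp add: gauss_def)
      qed
      show "AE y in lborel. norm (?I y * (((\<epsilon> k)\<^sup>2 + 2) powr ?p * gauss y ((\<epsilon> k)\<^sup>2 + 2) 0 0 * I)) \<le> ?I y * \<bar>I\<bar>" for k
      proof (rule AE_I2)
        fix y :: 'a
        have pos: "0 < (\<epsilon> k)\<^sup>2 + 2"
          by (simp add: add_nonneg_pos)
        \<comment> \<open>The base exceeds 1 and the exponent is not positive.\<close>
        have "((\<epsilon> k)\<^sup>2 + 2) powr ?p \<le> ((\<epsilon> k)\<^sup>2 + 2) powr 0"
          by (rule powr_mono) auto
        then have "((\<epsilon> k)\<^sup>2 + 2) powr ?p * gauss y ((\<epsilon> k)\<^sup>2 + 2) 0 0 \<le> 1 * 1"
          using pos by (intro mult_mono gauss_le_1 gauss_nonneg) auto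
        then have "((\<epsilon> k)\<^sup>2 + 2) powr ?p * gauss y ((\<epsilon> k)\<^sup>2 + 2) 0 0 * \<bar>I\<bar> \<le> \<bar>I\<bar>"
          by (intro mult_left_le_one_le) (auto simp: gauss_nonneg)
        then show "norm (?I y * (((\<epsilon> k)\<^sup>2 + 2) powr ?p * gauss y ((\<epsilon> k)\<^sup>2 + 2) 0 0 * I)) \<le> ?I y * \<bar>I\<bar>"
          by (auto simp: indicator_def abs_mult gauss_nonneg)
      qed
      show "(\<lambda>y. ?I y * (((\<epsilon> k)\<^sup>2 + 2) powr ?p * gauss y ((\<epsilon> k)\<^sup>2 + 2) 0 0 * I)) \<in> borel_measurable lborel" for k
        unfolding gauss_def by measurable
    qed measurable
    ultimately have "Z * (LINT x:box a b|lborel. h x) = (LINT y|lborel. ?I y * (2 powr ?p * exp (- (norm y)\<^sup>2 / 4) * I))"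
      by (rule LIMSEQ_unique)
    also have "\<dots> = c * (LINT x:box a b|lborel. exp (- (norm x)\<^sup>2 / 4))"
      unfolding set_lebesgue_integral_def c_def integral_mult_right_zero[symmetric] by (simp add: mult_ac)
    finally have eq: "Z * (LINT x:box a b|lborel. h x) = c * (LINT x:box a b|lborel. exp (- (norm x)\<^sup>2 / 4))" .
    have "set_integrable lborel (box a b) h" "set_integrable lborel (box a b) (\<lambda>x. exp (- (norm x)\<^sup>2 / 4))"
      unfolding set_integrable_def by (intro integrable_mult_indicator h E; simp)+
    then show ?thesis
      using eq by (subst set_integral_diff(2)) (auto intro: set_integrable_mult_right)
  qed
  then have "AE x in lborel. Z * h x - c * exp (- (norm x)\<^sup>2 / 4) = 0"
    using h E by (intro AE_zero_if_box_integrals_zero) auto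
  then have "AE x in lborel. h x = c / Z * exp (- (norm x)\<^sup>2 / 4)"
    by eventually_elim (use \<open>Z \<noteq> 0\<close> in \<open>simp add: field_simps\<close>)
  then show ?thesis by blast
qed

section \<open>Integrability from the growth bound, and the conclusion\<close>

lemma integrable_weight_growth:
  fixes u :: "'a::euclidean_space \<Rightarrow> real"
  assumes u: "L2_loc u" and "\<alpha> < 1"
    and growth: "ae_bigo_at_infinity u (\<lambda>x. exp (\<alpha> * (norm x)\<^sup>2 / 4))"
  shows "integrable lebesgue (\<lambda>x. (1 + (norm x)\<^sup>2) * (u x * exp (- (norm x)\<^sup>2 / 4)))"
proof -
  obtain w where uw: "AE x in lebesgue. u x = w x" and w: "w \<in> O[at_infinity](\<lambda>x. exp (\<alpha> * (norm x)\<^sup>2 / 4))"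
    using growth by (auto simp: ae_bigo_at_infinity_def)
  obtain c where c: "0 < c" and ev: "\<forall>\<^sub>F x in at_infinity. norm (w x) \<le> c * norm (exp (\<alpha> * (norm x)\<^sup>2 / 4))"
    using landau_o.bigE[OF w] by blast
  obtain r where r: "\<And>x. r \<le> norm x \<Longrightarrow> \<bar>w x\<bar> \<le> c * exp (\<alpha> * (norm x)\<^sup>2 / 4)"
    using ev by (auto simp: eventually_at_infinity)
  \<comment> \<open>Outside a ball, u times the weight decays at rate (1 - \<alpha>)/4, which is at
    least 2\<beta>. One \<beta> absorbs the polynomial, as 1 + |x|^2 <= exp(\<beta>|x|^2)/\<beta>
    for \<beta> <= 1; the other leaves the integrable \<open>?G\<close>. On the ball, where the
    growth bound says nothing, \<open>?H\<close> uses local square integrability.\<close>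
  define \<beta> where "\<beta> = min 1 ((1 - \<alpha>) / 8)"
  have \<beta>: "0 < \<beta>" "\<beta> \<le> 1" "\<beta> \<le> (1 - \<alpha>) / 8"
    using \<open>\<alpha> < 1\<close> min.cobounded2[of 1 "(1 - \<alpha>) / 8"] unfolding \<beta>_def by auto
  let ?K = "cball (0::'a) r"
  let ?f = "\<lambda>x::'a. exp (- (norm x)\<^sup>2 / 4)"
  let ?G = "\<lambda>x::'a. c / \<beta> * exp (- \<beta> * (norm x)\<^sup>2)"
  let ?H = "\<lambda>x. (1 + r\<^sup>2) * (indicator ?K x * ((u x)\<^sup>2 + 1))"
  have "set_integrable lebesgue ?K (\<lambda>x. (norm (u x))\<^sup>2)"
    using u by (auto simp: L2_loc_def)
  moreover have "set_integrable lebesgue ?K (\<lambda>x. 1::real)"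
    by (simp add: set_integrable_def lmeasurable_iff_integrable[symmetric])
  ultimately have "set_integrable lebesgue ?K (\<lambda>x. (norm (u x))\<^sup>2 + 1)"
    by (rule set_integral_add(1))
  then have H: "integrable lebesgue ?H"
    by (simp add: set_integrable_def)
  have "integrable lborel ?G"
    using integrable_exp_norm_square[OF \<beta>(1), where 'a='a] by simp
  then have G: "integrable lebesgue ?G"
    by (subst integrable_completion) auto
  have [measurable]: "u \<in> borel_measurable lebesgue"
    using u by (simp add: L2_loc_def)
  have [measurable]: "?f \<in> borel_measurable lebesgue" "(\<lambda>x::'a. 1 + (norm x)\<^sup>2) \<in> borel_measurable lebesgue"
    by (rule measurable_completion, simp)+
  show ?thesis
  proof (rule Bochner_Integration.integrable_bound[OF Bochner_Integration.integrable_add[OF H G]])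
    show "AE x in lebesgue. norm ((1 + (norm x)\<^sup>2) * (u x * ?f x)) \<le> norm (?H x + ?G x)"
      using uw
    proof eventually_elim
      fix x
      assume ux: "u x = w x"
      have nonneg: "0 \<le> ?H x" "0 \<le> ?G x"
        using c \<beta>(1) by (auto simp: indicator_def)
      have "(1 + (norm x)\<^sup>2) * (\<bar>u x\<bar> * ?f x) \<le> ?H x + ?G x"
      proof (cases "norm x \<le> r")
        case True
        have "\<bar>u x\<bar> \<le> (u x)\<^sup>2 + 1"
          using zero_le_power2[of "\<bar>u x\<bar> - 1"] by (simp add: power2_eq_square algebra_simps)
        then have "\<bar>u x\<bar> * ?f x \<le> ((u x)\<^sup>2 + 1) * 1"
          by (intro mult_mono) auto
        moreover have "1 + (norm x)\<^sup>2 \<le> 1 + r\<^sup>2"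
          using True by (simp add: power_mono)
        ultimately have "(1 + (norm x)\<^sup>2) * (\<bar>u x\<bar> * ?f x) \<le> (1 + r\<^sup>2) * (((u x)\<^sup>2 + 1) * 1)"
          by - (rule mult_mono, auto)
        then show ?thesis using True nonneg(2) by simp
      next
        case False
        let ?t = "(norm x)\<^sup>2"
        have "\<bar>u x\<bar> * ?f x \<le> c * exp (\<alpha> * ?t / 4) * ?f x"
          using r[of x] False ux by (intro mult_right_mono) auto
        also have "\<dots> = c * exp (- (1 - \<alpha>) * ?t / 4)"
          by (simp add: mult.assoc exp_add[symmetric] algebra_simps diff_divide_distrib)
        also have "\<dots> \<le> c * exp (- (2 * \<beta>) * ?t)"
        proof -
          have "(2 * \<beta>) * ?t \<le> ((1 - \<alpha>) / 4) * ?t"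
            using \<beta>(3) by (intro mult_right_mono) auto
          then show ?thesis using c by (simp add: left_diff_distrib)
        qed
        finally have 1: "\<bar>u x\<bar> * ?f x \<le> c * exp (- (2 * \<beta>) * ?t)" .
        have "\<beta> * (1 + ?t) \<le> exp (\<beta> * ?t)"
          using exp_ge_add_one_self[of "\<beta> * ?t"] \<beta>(2) unfolding distrib_left mult_1_right by linarith
        then have 2: "1 + ?t \<le> exp (\<beta> * ?t) / \<beta>"
          using \<beta>(1) by (simp add: field_simps)
        have "(1 + ?t) * (\<bar>u x\<bar> * ?f x) \<le> exp (\<beta> * ?t) / \<beta> * (c * exp (- (2 * \<beta>) * ?t))"
          using 1 2 \<beta>(1) by - (rule mult_mono, auto)
        also have "\<dots> = c / \<beta> * (exp (\<beta> * ?t) * exp (- (2 * \<beta>) * ?t))"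
          by simp
        also have "\<dots> = ?G x"
          by (simp only: exp_add[symmetric]) (simp add: algebra_simps)
        finally show ?thesis using nonneg(1) by linarith
      qed
      then show "norm ((1 + (norm x)\<^sup>2) * (u x * ?f x)) \<le> norm (?H x + ?G x)"
        using nonneg by (simp add: abs_mult)
    qed
  qed measurable
qed

theorem corollary2p3:
  fixes u :: "real ^ 'n \<Rightarrow> real" and \<alpha> :: real
  assumes "f_harmonic (\<lambda>x. (norm x)\<^sup>2 / 4) u"
    and "0 < \<alpha>" and "\<alpha> < 1"
    and "ae_bigo_at_infinity u (\<lambda>x. exp (\<alpha> * (norm x)\<^sup>2 / 4))"
  shows "\<exists>c. AE x in lebesgue. u x = c"
proof -
  let ?f = "\<lambda>x::real ^ 'n. exp (- (norm x)\<^sup>2 / 4)"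
  have u: "L2_loc u"
    using assms(1) by (auto simp: f_harmonic_def W12_loc_grad_def)
  note int = integrable_weight_growth[OF u assms(3,4)]
  have u_meas [measurable]: "u \<in> borel_measurable lebesgue"
    using u by (simp add: L2_loc_def)
  \<comment> \<open>The Fubini and box arguments are set on \<open>lborel\<close> and need Borel
    functions, so \<open>u\<close> is replaced by a Borel representative.\<close>
  obtain u' where u' [measurable]: "u' \<in> borel_measurable borel" and uu': "AE x in lborel. u x = u' x"
    using completion_ex_borel_measurable_real[OF u_meas] by auto
  have [measurable]: "?f \<in> borel_measurable lebesgue" "u' \<in> borel_measurable lebesgue"
    by (rule measurable_completion, simp)+
  have uu'_leb: "AE x in lebesgue. u x = u' x"
    using uu' by (rule AE_completion)
  have to_lborel: "(LINT x|lebesgue. u x * ?f x * g x) = (LINT x|lborel. u' x * ?f x * g x)"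
    if [measurable]: "g \<in> borel_measurable borel" for g
  proof -
    have [measurable]: "g \<in> borel_measurable lebesgue"
      by (rule measurable_completion) simp
    have "(LINT x|lebesgue. u x * ?f x * g x) = (LINT x|lebesgue. u' x * ?f x * g x)"
    proof (rule integral_cong_AE)
      show "AE x in lebesgue. u x * ?f x * g x = u' x * ?f x * g x"
        using uu'_leb by eventually_elim simp
    qed measurable
    also have "\<dots> = (LINT x|lborel. u' x * ?f x * g x)"
      by (rule integral_completion) measurable
    finally show ?thesis .
  qed
  have "integrable lebesgue (\<lambda>x. u' x * ?f x)"
  proof (rule Bochner_Integration.integrable_bound[OF int])
    show "AE x in lebesgue. norm (u' x * ?f x) \<le> norm ((1 + (norm x)\<^sup>2) * (u x * ?f x))"
      using uu'_leb
    proof eventually_elim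
      case (elim x)
      have "1 * \<bar>u' x * ?f x\<bar> \<le> (1 + (norm x)\<^sup>2) * \<bar>u' x * ?f x\<bar>"
        by (intro mult_right_mono) auto
      then show ?case using elim by (simp add: abs_mult)
    qed
  qed measurable
  then have h: "integrable lborel (\<lambda>x. u' x * ?f x)"
    by (subst (asm) integrable_completion) auto
  have "s powr (- (real DIM(real ^ 'n) / 2)) * (LINT x|lborel. u' x * ?f x * gauss y s 1 x)
      = (s + 2) powr (- (real DIM(real ^ 'n) / 2)) * gauss y (s + 2) 0 0 * (LINT x|lborel. u' x * ?f x)"
    if "0 < s" for s and y :: "real ^ 'n"
    using f_harmonic_gauss_transport[OF assms(1) int that, of y]
      to_lborel[OF borel_measurable_C_k[OF C_k_gauss], of y s 1] to_lborel[of "\<lambda>_. 1"] by simp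
  from AE_eq_exp_if_transport[OF h this]
  obtain c where "AE x in lborel. u' x * ?f x = c * ?f x" by blast
  \<comment> \<open>The Gaussian weight is nonzero everywhere and cancels.\<close>
  with uu' have "AE x in lborel. u x = c"
    by eventually_elim simp
  then show ?thesis by (blast intro: AE_completion)
qed

end
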